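(* Let $f:\mathbb{R}\to\mathbb{R}$ be continuous and bounded from above and $g:[0,\infty)\to\mathbb{R}$ be continuous. Fix $x\in\mathbb{R}$ and $\epsilon>0$. Let $y\ge 0$ be $\epsilon$-suboptimal for the problem $\sup_{y'\ge 0}[w(x,y')+g(y')]$ (whose value equals $v(x)$), i.e. $v(x)\le w(x,y)+g(y)+\epsilon$, and let $\alpha\in\mathcal{A}$ be $\epsilon$-suboptimal for $w(x,y)$, i.e. $w(x,y)\le\mathbb{E}^x[f(W(\tau^\alpha))]+\epsilon$, where $$\tau^\alpha:=\inf\left\{t\ge 0 : y-t+\int_0^t\alpha(s)\,dW(s)=0\right\}.$$ Then $\tau^\alpha\in\mathcal{T}$, and $\tau^\alpha$ is $(2\epsilon)$-suboptimal for the time-inconsistent stopping problem, i.e. $v(x)\le \mathbb{E}^x[f(W(\tau^\alpha))]+g(\mathbb{E}^x[\tau^\alpha])+2\epsilon$.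
   Context: $W$ is a standard one-dimensional Brownian motion on a probability space $(\Omega,\mathcal{F},\mathbb{P})$, and $\mathbb{F}=\{\mathcal{F}_t\}_{t\ge 0}$ is its augmented canonical filtration. $\mathbb{P}^x$ (expectation $\mathbb{E}^x$) denotes the measure under which $W$ starts at $x\in\mathbb{R}$. $\mathcal{T}$ is the collection of all $\mathbb{F}$-stopping times $\tau$ with $\mathbb{E}^x[\tau^2]<\infty$. $\mathcal{A}$ is the collection of all real-valued, progressively measurable processes $\alpha$ that are square-integrable, i.e. $\mathbb{E}^x\left[\int_0^\infty\alpha(s)^2\,ds\right]<\infty$. The time-inconsistent stopping problem is $v(x):=\sup_{\tau\in\mathcal{T}}\left(\mathbb{E}^x[f(W(\tau))]+g(\mathbb{E}^x[\tau])\right)$. The auxiliary value function is $w(x,y):=\sup_{\alpha\in\mathcal{A}}\mathbb{E}^x[f(W(\tau^{\alpha}))]$ for $(x,y)\in\mathbb{R}\times[0,\infty)$, with $\tau^\alpha$ the first time $t\geq 0$ at which $y-t+\int_0^t\alpha(s)\,dW(s)=0$. *)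

theory Defs
  imports "HOL-Probability.Probability"
begin

text \<open>
  Processes have time set \<open>[0,\<infinity>)\<close> and are functions \<open>real \<Rightarrow> 'a \<Rightarrow> real\<close> that are only ever
  looked at for nonnegative times. Filtrations and stopping times are indexed by, respectively take
  values in, \<open>[0,\<infinity>]\<close>, i.e. the type \<^typ>\<open>ennreal\<close>.
\<close>

definition canonical_filtration :: "'a measure \<Rightarrow> (real \<Rightarrow> 'a \<Rightarrow> real) \<Rightarrow> ennreal \<Rightarrow> 'a measure" where
  "canonical_filtration M W t =
     sigma (space M) {W s -` A \<inter> space M | s A. 0 \<le> s \<and> ennreal s \<le> t \<and> A \<in> sets borel}"

definition augmented_filtration :: "'a measure \<Rightarrow> (real \<Rightarrow> 'a \<Rightarrow> real) \<Rightarrow> ennreal \<Rightarrow> 'a measure" where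
  "augmented_filtration M W t =
     sigma (space M) (sets (canonical_filtration M W t) \<union> null_sets (completion M))"

lemma filtration_augmented_filtration: "filtration (space M) (augmented_filtration M W)"
proof
  let ?C = "\<lambda>t. {W s -` A \<inter> space M | s A. 0 \<le> s \<and> ennreal s \<le> t \<and> A \<in> sets borel}"
  have C: "?C t \<subseteq> Pow (space M)" for t by blast
  have "sets (canonical_filtration M W t) \<subseteq> Pow (space M)" for t
    using sets.space_closed[of "canonical_filtration M W t"]
    by (simp add: canonical_filtration_def space_measure_of[OF C])
  moreover have "null_sets (completion M) \<subseteq> Pow (space M)"
    using sets.space_closed[of "completion M"] by (auto simp: null_sets_def)
  ultimately have sub:
    "sets (canonical_filtration M W t) \<union> null_sets (completion M) \<subseteq> Pow (space M)" for t
    by simp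
  fix s t :: ennreal
  show "space (augmented_filtration M W t) = space M"
    unfolding augmented_filtration_def by (rule space_measure_of[OF sub])
  assume "s \<le> t"
  then have "?C s \<subseteq> ?C t" by (blast intro: order_trans)
  then have "sets (canonical_filtration M W s) \<subseteq> sets (canonical_filtration M W t)"
    unfolding canonical_filtration_def sets_measure_of[OF C] by (rule sigma_sets_mono')
  then show "sets (augmented_filtration M W s) \<subseteq> sets (augmented_filtration M W t)"
    unfolding augmented_filtration_def sets_measure_of[OF sub]
    by (intro sigma_sets_mono' Un_mono order_refl)
qed

definition brownian_motion :: "'a measure \<Rightarrow> (real \<Rightarrow> 'a \<Rightarrow> real) \<Rightarrow> real \<Rightarrow> bool" where
  "brownian_motion M W x \<longleftrightarrow>
     prob_space M \<and>
     (\<forall>t\<ge>0. W t \<in> borel_measurable M) \<and>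
     (\<forall>\<omega>\<in>space M. continuous_on {0..} (\<lambda>t. W t \<omega>)) \<and>
     (AE \<omega> in M. W 0 \<omega> = x) \<and>
     (\<forall>s t. 0 \<le> s \<and> s < t \<longrightarrow>
        distributed M lborel (\<lambda>\<omega>. W t \<omega> - W s \<omega>) (normal_density 0 (sqrt (t - s))) \<and>
        prob_space.indep_set M
          {(\<lambda>\<omega>. W t \<omega> - W s \<omega>) -` A \<inter> space M | A. A \<in> sets borel}
          (sets (canonical_filtration M W (ennreal s))))"

text \<open>
  The family \<open>\<bbbP>\<^sup>x\<close>: one process \<open>W\<close> on one measurable space, started at \<open>x\<close> under \<open>P x\<close>. The original
  measure, under which \<open>W\<close> is standard, is \<open>P 0\<close>.
\<close>

definition brownian_family :: "(real \<Rightarrow> 'a measure) \<Rightarrow> (real \<Rightarrow> 'a \<Rightarrow> real) \<Rightarrow> bool" where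
  "brownian_family P W \<longleftrightarrow>
     (\<forall>x. brownian_motion (P x) W x \<and> space (P x) = space (P 0) \<and> sets (P x) = sets (P 0))"

definition progressively_measurable ::
    "(ennreal \<Rightarrow> 'a measure) \<Rightarrow> (real \<Rightarrow> 'a \<Rightarrow> real) \<Rightarrow> bool" where
  "progressively_measurable F \<alpha> \<longleftrightarrow>
     (\<forall>t\<ge>0. (\<lambda>(s, \<omega>). \<alpha> s \<omega>) \<in>
        borel_measurable (restrict_space borel {0..t} \<Otimes>\<^sub>M F (ennreal t)))"

text \<open>\<open>\<bbbE>[\<integral>\<^sub>0\<^sup>\<infinity> \<alpha>(s)\<^sup>2 ds]\<close>\<close>

definition energy :: "'a measure \<Rightarrow> (real \<Rightarrow> 'a \<Rightarrow> real) \<Rightarrow> ennreal" where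
  "energy M \<alpha> = (\<integral>\<^sup>+\<omega>. (\<integral>\<^sup>+s\<in>{0..}. ennreal ((\<alpha> s \<omega>)\<^sup>2) \<partial>lborel) \<partial>M)"

text \<open>
  The data \<open>n, t, \<xi>\<close> encode the simple process \<open>\<Sum>i<n. \<xi>\<^sub>i 1\<^bsub>(t\<^sub>i, t\<^sub>i\<^sub>+\<^sub>1]\<^esub>\<close>.
\<close>

definition simple_data ::
    "(ennreal \<Rightarrow> 'a measure) \<Rightarrow> nat \<Rightarrow> (nat \<Rightarrow> real) \<Rightarrow> (nat \<Rightarrow> 'a \<Rightarrow> real) \<Rightarrow> bool" where
  "simple_data F n t \<xi> \<longleftrightarrow>
     0 \<le> t 0 \<and>
     (\<forall>i<n. t i < t (Suc i) \<and>
        \<xi> i \<in> borel_measurable (F (ennreal (t i))) \<and>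
        bounded (\<xi> i ` space (F (ennreal (t i)))))"

definition simple_process ::
    "nat \<Rightarrow> (nat \<Rightarrow> real) \<Rightarrow> (nat \<Rightarrow> 'a \<Rightarrow> real) \<Rightarrow> real \<Rightarrow> 'a \<Rightarrow> real" where
  "simple_process n t \<xi> s \<omega> = (\<Sum>i<n. \<xi> i \<omega> * indicator {t i<..t (Suc i)} s)"

definition simple_integral ::
    "(real \<Rightarrow> 'a \<Rightarrow> real) \<Rightarrow> nat \<Rightarrow> (nat \<Rightarrow> real) \<Rightarrow> (nat \<Rightarrow> 'a \<Rightarrow> real) \<Rightarrow> real \<Rightarrow> 'a \<Rightarrow> real" where
  "simple_integral W n t \<xi> s \<omega> =
     (\<Sum>i<n. \<xi> i \<omega> * (W (min (t (Suc i)) s) \<omega> - W (min (t i) s) \<omega>))"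

text \<open>
  \<open>I\<close> is a continuous version of the Ito integral process \<open>t \<mapsto> \<integral>\<^sub>0\<^sup>t \<alpha>(s) dW(s)\<close>: continuous, adapted,
  and the \<open>L\<^sup>2\<close>-limit at each time of integrals of simple processes approximating \<open>\<alpha>\<close> in
  \<open>L\<^sup>2(ds \<otimes> d\<bbbP>)\<close>. As the Ito integral is determined up to indistinguishability only, this is a
  relation between \<open>\<alpha>\<close> and \<open>I\<close> (in the style of \<^const>\<open>has_integral\<close>).
\<close>

definition has_ito_integral ::
    "'a measure \<Rightarrow> (ennreal \<Rightarrow> 'a measure) \<Rightarrow> (real \<Rightarrow> 'a \<Rightarrow> real) \<Rightarrow>
     (real \<Rightarrow> 'a \<Rightarrow> real) \<Rightarrow> (real \<Rightarrow> 'a \<Rightarrow> real) \<Rightarrow> bool" where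
  "has_ito_integral M F W \<alpha> I \<longleftrightarrow>
     (\<forall>t\<ge>0. I t \<in> borel_measurable (F (ennreal t))) \<and>
     (\<forall>\<omega>\<in>space M. continuous_on {0..} (\<lambda>t. I t \<omega>)) \<and>
     (\<exists>n t \<xi>.
        (\<forall>k. simple_data F (n k) (t k) (\<xi> k)) \<and>
        (\<lambda>k. energy M (\<lambda>s \<omega>. simple_process (n k) (t k) (\<xi> k) s \<omega> - \<alpha> s \<omega>)) \<longlonglongrightarrow> 0 \<and>
        (\<forall>s\<ge>0. (\<lambda>k. \<integral>\<^sup>+\<omega>. ennreal ((simple_integral W (n k) (t k) (\<xi> k) s \<omega> - I s \<omega>)\<^sup>2) \<partial>M)
                  \<longlonglongrightarrow> 0))"

text \<open>
  Expectations are taken under the completion of \<open>P x\<close>, since the augmented filtration contains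
  sets that need not lie in the original \<open>\<sigma>\<close>-algebra.
\<close>

abbreviation law :: "(real \<Rightarrow> 'a measure) \<Rightarrow> real \<Rightarrow> 'a measure" where
  "law P x \<equiv> completion (P x)"

abbreviation filt ::
    "(real \<Rightarrow> 'a measure) \<Rightarrow> (real \<Rightarrow> 'a \<Rightarrow> real) \<Rightarrow> real \<Rightarrow> ennreal \<Rightarrow> 'a measure" where
  "filt P W x \<equiv> augmented_filtration (P x) W"

definition stopping_times ::
    "(real \<Rightarrow> 'a measure) \<Rightarrow> (real \<Rightarrow> 'a \<Rightarrow> real) \<Rightarrow> real \<Rightarrow> ('a \<Rightarrow> ennreal) set" where
  "stopping_times P W x =
     {\<tau>. stopping_time (filt P W x) \<tau> \<and> (\<integral>\<^sup>+\<omega>. (\<tau> \<omega>)\<^sup>2 \<partial>law P x) < \<infinity>}"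

definition controls ::
    "(real \<Rightarrow> 'a measure) \<Rightarrow> (real \<Rightarrow> 'a \<Rightarrow> real) \<Rightarrow> real \<Rightarrow> (real \<Rightarrow> 'a \<Rightarrow> real) set" where
  "controls P W x =
     {\<alpha>. progressively_measurable (filt P W x) \<alpha> \<and> energy (law P x) \<alpha> < \<infinity>}"

abbreviation ito ::
    "(real \<Rightarrow> 'a measure) \<Rightarrow> (real \<Rightarrow> 'a \<Rightarrow> real) \<Rightarrow> real \<Rightarrow>
     (real \<Rightarrow> 'a \<Rightarrow> real) \<Rightarrow> (real \<Rightarrow> 'a \<Rightarrow> real) \<Rightarrow> bool" where
  "ito P W x \<equiv> has_ito_integral (law P x) (filt P W x) W"

text \<open>
  Since \<open>f\<close> is bounded from above but not from below, \<open>\<bbbE>[f(W(\<tau>))]\<close> may be \<open>-\<infinity>\<close>. The expectation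
  is therefore taken in \<open>[-\<infinity>,\<infinity>]\<close>, as \<open>\<bbbE>[X\<^sup>+] - \<bbbE>[X\<^sup>-]\<close>; below the first term is always finite.
\<close>

definition ext_expectation :: "'a measure \<Rightarrow> ('a \<Rightarrow> real) \<Rightarrow> ereal" where
  "ext_expectation M X =
     enn2ereal (\<integral>\<^sup>+\<omega>. ennreal (X \<omega>) \<partial>M) - enn2ereal (\<integral>\<^sup>+\<omega>. ennreal (- X \<omega>) \<partial>M)"

text \<open>
  \<open>\<bbbE>\<^sup>x[f(W(\<tau>))]\<close> and \<open>\<bbbE>\<^sup>x[\<tau>]\<close>. The convention \<open>enn2real \<infinity> = 0\<close> is immaterial for the stopping times
  used below, which are almost surely finite with finite mean.
\<close>

definition expected_payoff ::
    "(real \<Rightarrow> 'a measure) \<Rightarrow> (real \<Rightarrow> 'a \<Rightarrow> real) \<Rightarrow> (real \<Rightarrow> real) \<Rightarrow> real \<Rightarrow>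
     ('a \<Rightarrow> ennreal) \<Rightarrow> ereal" where
  "expected_payoff P W f x \<tau> = ext_expectation (law P x) (\<lambda>\<omega>. f (W (enn2real (\<tau> \<omega>)) \<omega>))"

definition expected_time :: "(real \<Rightarrow> 'a measure) \<Rightarrow> real \<Rightarrow> ('a \<Rightarrow> ennreal) \<Rightarrow> real" where
  "expected_time P x \<tau> = enn2real (\<integral>\<^sup>+\<omega>. \<tau> \<omega> \<partial>law P x)"

definition stopping_value ::
    "(real \<Rightarrow> 'a measure) \<Rightarrow> (real \<Rightarrow> 'a \<Rightarrow> real) \<Rightarrow> (real \<Rightarrow> real) \<Rightarrow> (real \<Rightarrow> real) \<Rightarrow> real \<Rightarrow> ereal" where
  "stopping_value P W f g x =
     (SUP \<tau>\<in>stopping_times P W x. expected_payoff P W f x \<tau> + ereal (g (expected_time P x \<tau>)))"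

text \<open>\<open>\<tau>\<^sup>\<alpha>\<close>, in terms of the integral process \<open>I = \<integral>\<^sub>0 \<alpha> dW\<close>\<close>

definition hitting_time :: "real \<Rightarrow> (real \<Rightarrow> 'a \<Rightarrow> real) \<Rightarrow> 'a \<Rightarrow> ennreal" where
  "hitting_time y I \<omega> = Inf {ennreal t | t. 0 \<le> t \<and> y - t + I t \<omega> = 0}"

definition aux_value ::
    "(real \<Rightarrow> 'a measure) \<Rightarrow> (real \<Rightarrow> 'a \<Rightarrow> real) \<Rightarrow> (real \<Rightarrow> real) \<Rightarrow> real \<Rightarrow> real \<Rightarrow> ereal" where
  "aux_value P W f x y =
     (SUP (\<alpha>, I)\<in>{(\<alpha>, I). \<alpha> \<in> controls P W x \<and> ito P W x \<alpha> I}.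
        expected_payoff P W f x (hitting_time y I))"

end

theory Submission
  imports Defs
begin

text \<open>
  Let \<open>\<tau>\<close> be the hitting time and \<open>I = \<integral> \<alpha> dW\<close>. Since \<open>I\<close> is a continuous martingale bounded in \<open>L\<^sup>2\<close> and
  \<open>I\<^sub>\<tau> = \<tau> - y\<close> on \<open>\<tau> < \<infinity>\<close>, optional stopping gives \<open>\<bbbE>[\<tau>] = y\<close> and \<open>\<bbbE>[\<tau>\<^sup>2] < \<infinity>\<close>; with \<open>\<bbbE>[\<tau>] = y\<close> the two
  suboptimality hypotheses just add up. Optional stopping is applied to discretisations of \<open>\<tau>\<close> taking
  finitely many values, where it only needs \<open>\<bbbE>[Z (I\<^sub>T - I\<^sub>s)] = 0\<close> for square-integrable
  \<open>\<F>\<^sub>s\<close>-measurable \<open>Z\<close>; the \<open>L\<^sup>2\<close> bound allows the passage to the limit.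
\<close>

subsection \<open>Square-integrable functions\<close>

text \<open>The integral \<open>I\<close> is given only as an \<open>L^2\<close>-limit at each time
  separately, so all that is known about it comes from simple processes: orthogonality of later
  increments to the past survives the limit by Cauchy-Schwarz, and one half of the Ito isometry
  bounds \<open>E[I_s^2]\<close> uniformly in \<open>s\<close>. The obstacle is that
  \<open>\<tau>\<close> is not known to be finite in advance. If \<open>\<tau>\<close> is infinite,
  the path of \<open>y - t + I_t\<close> starts at \<open>y \<ge> 0\<close> and has no zero, so it
  stays positive and \<open>I_t\<close> exceeds \<open>t - y\<close> for all \<open>t\<close>; such
  growth has probability zero under a uniform \<open>L^2\<close> bound. Only after this are means
  passed to the limit, where uniform integrability turns the vanishing means of the stopped
  integrals into an equality for the mean of \<open>\<tau>\<close> instead of an inequality. The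
  discretisations round upwards because only then is the event of stopping at a grid time known at
  that time.\<close>

definition square_integrable :: "'a measure \<Rightarrow> ('a \<Rightarrow> real) \<Rightarrow> bool" where
  "square_integrable M X \<longleftrightarrow> X \<in> borel_measurable M \<and> integrable M (\<lambda>\<omega>. (X \<omega>)\<^sup>2)"

lemma square_integrableI [intro?]:
  "X \<in> borel_measurable M \<Longrightarrow> integrable M (\<lambda>\<omega>. (X \<omega>)\<^sup>2) \<Longrightarrow> square_integrable M X"
  by (simp add: square_integrable_def)

lemma square_integrable_measurable [measurable_dest]:
  "square_integrable M X \<Longrightarrow> X \<in> borel_measurable M"
  by (simp add: square_integrable_def)

lemma square_integrable_cong:
  assumes "\<And>\<omega>. \<omega> \<in> space M \<Longrightarrow> X \<omega> = Y \<omega>"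
  shows "square_integrable M X \<longleftrightarrow> square_integrable M Y"
proof -
  have "X \<in> borel_measurable M \<longleftrightarrow> Y \<in> borel_measurable M"
    by (rule measurable_cong) (rule assms)
  moreover have "integrable M (\<lambda>\<omega>. (X \<omega>)\<^sup>2) \<longleftrightarrow> integrable M (\<lambda>\<omega>. (Y \<omega>)\<^sup>2)"
    using assms by (intro Bochner_Integration.integrable_cong) auto
  ultimately show ?thesis by (simp add: square_integrable_def)
qed

lemma square_integrable_square: "square_integrable M X \<Longrightarrow> integrable M (\<lambda>\<omega>. (X \<omega>)\<^sup>2)"
  by (simp add: square_integrable_def)

lemma square_integrable_nn:
  assumes "X \<in> borel_measurable M" "(\<integral>\<^sup>+\<omega>. ennreal ((X \<omega>)\<^sup>2) \<partial>M) < \<infinity>"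
  shows "square_integrable M X"
  using assms by (auto intro!: square_integrableI integrableI_nonneg)

lemma square_integrable_mult:
  assumes "square_integrable M X" "square_integrable M Y"
  shows "integrable M (\<lambda>\<omega>. X \<omega> * Y \<omega>)"
proof (rule Bochner_Integration.integrable_bound)
  show "integrable M (\<lambda>\<omega>. (X \<omega>)\<^sup>2 + (Y \<omega>)\<^sup>2)"
    using assms by (simp add: square_integrable_square)
  have "\<bar>a * b\<bar> \<le> a\<^sup>2 + b\<^sup>2" for a b :: real
    using zero_le_power2[of "\<bar>a\<bar> - \<bar>b\<bar>"] zero_le_power2[of a] zero_le_power2[of b]
    unfolding power2_diff abs_mult power2_abs by linarith
  then show "AE \<omega> in M. norm (X \<omega> * Y \<omega>) \<le> norm ((X \<omega>)\<^sup>2 + (Y \<omega>)\<^sup>2)"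
    by simp
qed (use assms in measurable)

lemma square_integrable_add:
  assumes "square_integrable M X" "square_integrable M Y"
  shows "square_integrable M (\<lambda>\<omega>. X \<omega> + Y \<omega>)"
proof
  show "integrable M (\<lambda>\<omega>. (X \<omega> + Y \<omega>)\<^sup>2)"
    using assms square_integrable_mult[OF assms]
    by (simp add: power2_sum square_integrable_square mult.assoc)
qed (use assms in measurable)

lemma square_integrable_cmult:
  "square_integrable M X \<Longrightarrow> square_integrable M (\<lambda>\<omega>. c * X \<omega>)"
  by (auto simp: square_integrable_def power_mult_distrib)

lemma square_integrable_diff:
  assumes "square_integrable M X" "square_integrable M Y"
  shows "square_integrable M (\<lambda>\<omega>. X \<omega> - Y \<omega>)"
  using square_integrable_add[OF assms(1) square_integrable_cmult[OF assms(2), of "-1"]] by simp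

lemma square_integrable_bounded_mult:
  assumes [measurable]: "\<xi> \<in> borel_measurable M" and X: "square_integrable M X"
    and B: "\<And>\<omega>. \<omega> \<in> space M \<Longrightarrow> \<bar>\<xi> \<omega>\<bar> \<le> B"
  shows "square_integrable M (\<lambda>\<omega>. \<xi> \<omega> * X \<omega>)"
proof
  note [measurable] = square_integrable_measurable[OF X]
  show "(\<lambda>\<omega>. \<xi> \<omega> * X \<omega>) \<in> borel_measurable M"
    by measurable
  show "integrable M (\<lambda>\<omega>. (\<xi> \<omega> * X \<omega>)\<^sup>2)"
  proof (rule Bochner_Integration.integrable_bound)
    show "integrable M (\<lambda>\<omega>. B\<^sup>2 * (X \<omega>)\<^sup>2)"
      using X by (simp add: square_integrable_square)
    show "AE \<omega> in M. norm ((\<xi> \<omega> * X \<omega>)\<^sup>2) \<le> norm (B\<^sup>2 * (X \<omega>)\<^sup>2)"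
    proof (rule AE_I2)
      fix \<omega> assume "\<omega> \<in> space M"
      then have "\<bar>\<xi> \<omega>\<bar> \<le> \<bar>B\<bar>"
        using B by fastforce
      then show "norm ((\<xi> \<omega> * X \<omega>)\<^sup>2) \<le> norm (B\<^sup>2 * (X \<omega>)\<^sup>2)"
        by (simp add: power_mult_distrib mult_right_mono abs_le_square_iff)
    qed
  qed measurable
qed

lemma square_integrable_indicator_mult:
  "A \<in> sets M \<Longrightarrow> square_integrable M X \<Longrightarrow> square_integrable M (\<lambda>\<omega>. indicator A \<omega> * X \<omega>)"
  by (rule square_integrable_bounded_mult[where B=1]) (auto split: split_indicator)

lemma square_integrable_sum:
  "(\<And>i. i \<in> J \<Longrightarrow> square_integrable M (X i)) \<Longrightarrow> square_integrable M (\<lambda>\<omega>. \<Sum>i\<in>J. X i \<omega>)"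
  by (induction J rule: infinite_finite_induct)
    (auto simp: square_integrable_add square_integrable_def[of M "\<lambda>_. 0"])

text \<open>The right-hand side is kept in \<open>ennreal\<close> because
  \<open>has_ito_integral\<close> states its convergence with nonnegative integrals.\<close>

lemma Cauchy_Schwarz_square_integrable:
  assumes "square_integrable M X" "square_integrable M Y"
  shows "ennreal ((\<integral>\<omega>. X \<omega> * Y \<omega> \<partial>M)\<^sup>2)
           \<le> (\<integral>\<^sup>+\<omega>. ennreal ((X \<omega>)\<^sup>2) \<partial>M) * (\<integral>\<^sup>+\<omega>. ennreal ((Y \<omega>)\<^sup>2) \<partial>M)"
proof -
  note [measurable] = assms[THEN square_integrable_measurable]
  have "ennreal ((\<integral>\<omega>. X \<omega> * Y \<omega> \<partial>M)\<^sup>2) = (ennreal (norm (\<integral>\<omega>. X \<omega> * Y \<omega> \<partial>M)))\<^sup>2"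
    by (simp add: ennreal_power)
  also have "\<dots> \<le> (\<integral>\<^sup>+\<omega>. ennreal (norm (X \<omega> * Y \<omega>)) \<partial>M)\<^sup>2"
    by (intro power_mono integral_norm_bound_ennreal square_integrable_mult assms) simp
  also have "\<dots> = (\<integral>\<^sup>+\<omega>. ennreal \<bar>X \<omega>\<bar> * ennreal \<bar>Y \<omega>\<bar> \<partial>M)\<^sup>2"
    by (simp add: abs_mult ennreal_mult)
  also have "\<dots> \<le> (\<integral>\<^sup>+\<omega>. (ennreal \<bar>X \<omega>\<bar>)\<^sup>2 \<partial>M) * (\<integral>\<^sup>+\<omega>. (ennreal \<bar>Y \<omega>\<bar>)\<^sup>2 \<partial>M)"
    by (rule Cauchy_Schwarz_nn_integral) measurable
  finally show ?thesis
    by (simp add: ennreal_power)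
qed

lemma ennreal_power2_add_le: "ennreal ((a + b)\<^sup>2) \<le> 2 * ennreal (a\<^sup>2) + 2 * ennreal (b\<^sup>2)"
proof -
  have "ennreal ((a + b)\<^sup>2) \<le> ennreal (2 * a\<^sup>2 + 2 * b\<^sup>2)"
    using sum_squares_bound[of a b] by (intro ennreal_leI) (simp add: power2_sum)
  then show ?thesis
    by (simp add: ennreal_plus ennreal_mult)
qed

text \<open>Replaces the triangle inequality of \<open>L^2\<close> throughout; the lost factor 2 is
  harmless and no square roots of \<open>ennreal\<close> values appear.\<close>

lemma nn_integral_power2_add_le:
  assumes [measurable]: "X \<in> borel_measurable M" "Y \<in> borel_measurable M"
  shows "(\<integral>\<^sup>+\<omega>. ennreal ((X \<omega> + Y \<omega>)\<^sup>2) \<partial>M)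
           \<le> 2 * (\<integral>\<^sup>+\<omega>. ennreal ((X \<omega>)\<^sup>2) \<partial>M) + 2 * (\<integral>\<^sup>+\<omega>. ennreal ((Y \<omega>)\<^sup>2) \<partial>M)"
proof -
  have "(\<integral>\<^sup>+\<omega>. ennreal ((X \<omega> + Y \<omega>)\<^sup>2) \<partial>M)
          \<le> (\<integral>\<^sup>+\<omega>. 2 * ennreal ((X \<omega>)\<^sup>2) + 2 * ennreal ((Y \<omega>)\<^sup>2) \<partial>M)"
    by (intro nn_integral_mono ennreal_power2_add_le)
  then show ?thesis
    by (simp add: nn_integral_add nn_integral_cmult)
qed

text \<open>\<open>L\<^sup>2\<close>-boundedness gives uniform integrability: \<open>\<bar>d\<bar> \<le> min \<bar>d\<bar> K + d\<^sup>2 / K\<close>.\<close>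

lemma (in finite_measure) square_integrable_integrable:
  "square_integrable M X \<Longrightarrow> integrable M X"
  by (rule square_integrable_imp_integrable) (auto simp: square_integrable_def)

lemma (in prob_space) expectation_tendsto_of_L2_bounded:
  assumes [measurable]: "\<And>n. X n \<in> borel_measurable M" "Y \<in> borel_measurable M"
    and C: "\<And>n. (\<integral>\<^sup>+\<omega>. ennreal ((X n \<omega>)\<^sup>2) \<partial>M) \<le> ennreal C" "(\<integral>\<^sup>+\<omega>. ennreal ((Y \<omega>)\<^sup>2) \<partial>M) \<le> ennreal C"
    and lim: "AE \<omega> in M. (\<lambda>n. X n \<omega>) \<longlonglongrightarrow> Y \<omega>"
  shows "(\<lambda>n. expectation (X n)) \<longlonglongrightarrow> expectation Y"
proof -
  have sqX: "square_integrable M (X n)" and sqY: "square_integrable M Y" for n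
    using le_less_trans[OF C(1)] le_less_trans[OF C(2)] by (auto intro!: square_integrable_nn)
  have int: "integrable M (X n)" "integrable M Y" for n
    using sqX sqY by (auto intro: square_integrable_integrable)
  define D where "D n \<omega> = X n \<omega> - Y \<omega>" for n \<omega>
  have [measurable]: "D n \<in> borel_measurable M" for n
    unfolding D_def by measurable
  have sqD: "square_integrable M (D n)" for n
    unfolding D_def by (intro square_integrable_diff sqX sqY)
  have intD: "integrable M (D n)" for n
    unfolding D_def using int by simp
  \<comment> \<open>\<open>D n\<close> is a difference, so its second moment is at most 2C + 2C. The
    maximum covers negative \<open>C\<close>, for which \<open>ennreal C\<close> is 0.\<close>
  define C' where "C' = 4 * max C 0"
  have C'0: "0 \<le> C'" by (simp add: C'_def)
  have eD: "expectation (\<lambda>\<omega>. (D n \<omega>)\<^sup>2) \<le> C'" for n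
  proof -
    have bnd: "expectation (\<lambda>\<omega>. (Z \<omega>)\<^sup>2) \<le> max C 0"
      if "(\<integral>\<^sup>+\<omega>. ennreal ((Z \<omega>)\<^sup>2) \<partial>M) \<le> ennreal C" "square_integrable M Z" for Z
    proof -
      have "ennreal (expectation (\<lambda>\<omega>. (Z \<omega>)\<^sup>2)) = (\<integral>\<^sup>+\<omega>. ennreal ((Z \<omega>)\<^sup>2) \<partial>M)"
        using that(2) by (subst nn_integral_eq_integral) (auto dest: square_integrable_square)
      also have "\<dots> \<le> ennreal (max C 0)"
        using that(1) by (rule order_trans) (simp add: ennreal_leI)
      finally show ?thesis
        by (subst (asm) ennreal_le_iff) auto
    qed
    have "expectation (\<lambda>\<omega>. (D n \<omega>)\<^sup>2) \<le> expectation (\<lambda>\<omega>. 2 * (X n \<omega>)\<^sup>2 + 2 * (Y \<omega>)\<^sup>2)"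
    proof (rule integral_mono)
      fix \<omega> show "(D n \<omega>)\<^sup>2 \<le> 2 * (X n \<omega>)\<^sup>2 + 2 * (Y \<omega>)\<^sup>2"
        using zero_le_power2[of "X n \<omega> + Y \<omega>"] by (simp add: D_def power2_diff power2_sum)
    qed (simp_all add: square_integrable_square sqD sqX sqY)
    also have "\<dots> = 2 * expectation (\<lambda>\<omega>. (X n \<omega>)\<^sup>2) + 2 * expectation (\<lambda>\<omega>. (Y \<omega>)\<^sup>2)"
      using sqX sqY by (simp add: square_integrable_square)
    finally show ?thesis
      using bnd[OF C(1) sqX[of n]] bnd[OF C(2) sqY] by (simp add: C'_def)
  qed
  have main: "\<bar>expectation (D n)\<bar> \<le> expectation (\<lambda>\<omega>. min \<bar>D n \<omega>\<bar> K) + C' / K" if K: "K > 0" for n K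
  proof -
    have imin: "integrable M (\<lambda>\<omega>. min \<bar>D n \<omega>\<bar> K)"
      using intD by (intro integrable_min integrable_abs integrable_const)
    have isq: "integrable M (\<lambda>\<omega>. (D n \<omega>)\<^sup>2 / K)"
      using sqD by (simp add: square_integrable_square)
    have "\<bar>expectation (D n)\<bar> \<le> expectation (\<lambda>\<omega>. \<bar>D n \<omega>\<bar>)"
      by (rule integral_abs_bound)
    also have "\<dots> \<le> expectation (\<lambda>\<omega>. min \<bar>D n \<omega>\<bar> K + (D n \<omega>)\<^sup>2 / K)"
    proof (rule integral_mono)
      fix \<omega>
      show "\<bar>D n \<omega>\<bar> \<le> min \<bar>D n \<omega>\<bar> K + (D n \<omega>)\<^sup>2 / K"
      proof (cases "\<bar>D n \<omega>\<bar> \<le> K")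
        case False
        then have "\<bar>D n \<omega>\<bar> * K \<le> \<bar>D n \<omega>\<bar> * \<bar>D n \<omega>\<bar>"
          by (intro mult_left_mono) auto
        then have "\<bar>D n \<omega>\<bar> \<le> (D n \<omega>)\<^sup>2 / K"
          using K by (simp add: pos_le_divide_eq power2_eq_square)
        then show ?thesis using K by simp
      qed (use K in simp)
    qed (use intD imin isq in \<open>auto intro: Bochner_Integration.integrable_add\<close>)
    also have "\<dots> = expectation (\<lambda>\<omega>. min \<bar>D n \<omega>\<bar> K) + expectation (\<lambda>\<omega>. (D n \<omega>)\<^sup>2) / K"
      using imin isq by (simp add: Bochner_Integration.integral_add)
    finally show ?thesis
      using divide_right_mono[OF eD[of n], of K] K by simp
  qed
  have trunc: "(\<lambda>n. expectation (\<lambda>\<omega>. min \<bar>D n \<omega>\<bar> K)) \<longlonglongrightarrow> 0" if "K > 0" for K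
  proof -
    \<comment> \<open>The truncated differences are dominated by the constant \<open>K\<close>,
      whereas no integrable majorant of the \<open>D n\<close> themselves is available.\<close>
    have "(\<lambda>n. expectation (\<lambda>\<omega>. min \<bar>D n \<omega>\<bar> K)) \<longlonglongrightarrow> expectation (\<lambda>\<omega>. 0)"
    proof (rule integral_dominated_convergence[where w="\<lambda>_. K"])
      show "AE \<omega> in M. (\<lambda>n. min \<bar>D n \<omega>\<bar> K) \<longlonglongrightarrow> 0"
        using lim
      proof eventually_elim
        case (elim \<omega>)
        have "(\<lambda>n. D n \<omega>) \<longlonglongrightarrow> 0"
          using tendsto_diff[OF elim tendsto_const[of "Y \<omega>"]] by (simp add: D_def)
        then have "(\<lambda>n. min \<bar>D n \<omega>\<bar> K) \<longlonglongrightarrow> min \<bar>0\<bar> K"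
          by (intro tendsto_intros)
        then show ?case using \<open>K > 0\<close> by simp
      qed
    qed (use that in auto)
    then show ?thesis by simp
  qed
  have "(\<lambda>n. expectation (D n)) \<longlonglongrightarrow> 0"
  proof (rule LIMSEQ_I)
    fix r :: real assume r: "0 < r"
    \<comment> \<open>Makes the tail \<open>C' / K\<close> smaller than \<open>r / 2\<close>; the
      added 1 keeps \<open>K\<close> positive when \<open>C' = 0\<close>.\<close>
    define K where "K = 2 * (C' + 1) / r"
    have K: "K > 0" using r C'0 by (simp add: K_def)
    have "C' / K < r / 2"
      using r C'0 by (simp add: K_def field_simps)
    moreover obtain n0 where
      n0: "\<And>n. n \<ge> n0 \<Longrightarrow> norm (expectation (\<lambda>\<omega>. min \<bar>D n \<omega>\<bar> K) - 0) < r / 2"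
      using LIMSEQ_D[OF trunc[OF K], of "r / 2"] r by auto
    ultimately have "norm (expectation (D n) - 0) < r" if "n \<ge> n0" for n
      using main[OF K, of n] n0[OF that] unfolding real_norm_def diff_0_right by linarith
    then show "\<exists>n0. \<forall>n\<ge>n0. norm (expectation (D n) - 0) < r"
      by blast
  qed
  moreover have "expectation (D n) = expectation (X n) - expectation Y" for n
    unfolding D_def using int by simp
  ultimately show ?thesis
    by (simp add: LIM_zero_iff)
qed

subsection \<open>Brownian increments\<close>

locale brownian =
  fixes M :: "'a measure" and W :: "real \<Rightarrow> 'a \<Rightarrow> real" and x :: real
  assumes brownian_motion: "brownian_motion M W x"
begin

abbreviation "F \<equiv> augmented_filtration M W"

text \<open>The Brownian properties are stated for \<open>M\<close>, expectations are taken under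
  its completion. Qualifying the facts on \<open>M\<close> by \<open>base\<close> lets plain
  \<open>prob\<close>, \<open>expectation\<close> and \<open>indep_var\<close> mean the
  completion.\<close>

sublocale base: prob_space M
  using brownian_motion by (simp add: brownian_motion_def)

sublocale prob_space "completion M"
  by (rule prob_spaceI) (simp add: base.emeasure_space_1)

sublocale filtration "space M" F
  by (rule filtration_augmented_filtration)

lemma W_measurable: "0 \<le> t \<Longrightarrow> W t \<in> borel_measurable M"
  using brownian_motion unfolding brownian_motion_def by blast

lemma canonical_generator_subset:
  "{W s -` A \<inter> space M | s A. 0 \<le> s \<and> ennreal s \<le> t \<and> A \<in> sets borel} \<subseteq> sets M"
  using measurable_sets[OF W_measurable] by blast

lemma sets_canonical: "sets (canonical_filtration M W t) =
    sigma_sets (space M) {W s -` A \<inter> space M | s A. 0 \<le> s \<and> ennreal s \<le> t \<and> A \<in> sets borel}"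
  unfolding canonical_filtration_def
  by (rule sets_measure_of) blast

lemma sets_canonical_subset: "sets (canonical_filtration M W t) \<subseteq> sets M"
  unfolding sets_canonical by (rule sets.sigma_sets_subset[OF canonical_generator_subset])

lemma sets_F: "sets (F t) =
    sigma_sets (space M) (sets (canonical_filtration M W t) \<union> null_sets (completion M))"
  unfolding augmented_filtration_def
proof (rule sets_measure_of)
  show "sets (canonical_filtration M W t) \<union> null_sets (completion M) \<subseteq> Pow (space M)"
  proof (rule Un_least)
    show "sets (canonical_filtration M W t) \<subseteq> Pow (space M)"
      using sets_canonical_subset sets.space_closed by (rule order_trans)
    show "null_sets (completion M) \<subseteq> Pow (space M)"
      using sets.space_closed[of "completion M"] unfolding null_sets_def space_completion by blast
  qed
qed

lemma sets_F_subset: "sets (F t) \<subseteq> sets (completion M)"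
proof -
  have "sets (canonical_filtration M W t) \<union> null_sets (completion M) \<subseteq> sets (completion M)"
    using sets_canonical_subset[of t] unfolding null_sets_def by blast
  then have "sigma_sets (space (completion M)) (sets (canonical_filtration M W t) \<union> null_sets (completion M))
      \<subseteq> sets (completion M)"
    by (rule sets.sigma_sets_subset)
  then show ?thesis
    unfolding sets_F space_completion .
qed

lemma measurable_F_completion: "X \<in> F t \<rightarrow>\<^sub>M N \<Longrightarrow> X \<in> completion M \<rightarrow>\<^sub>M N"
  using sets_F_subset[of t] unfolding measurable_def space_F space_completion by blast

lemma measurable_F_mono: "X \<in> F s \<rightarrow>\<^sub>M N \<Longrightarrow> s \<le> t \<Longrightarrow> X \<in> F t \<rightarrow>\<^sub>M N"
  using sets_F_mono[of s t] unfolding measurable_def space_F by blast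

lemma W_adapted:
  assumes "0 \<le> s" "ennreal s \<le> t"
  shows "W s \<in> borel_measurable (F t)"
proof (rule measurableI)
  fix A :: "real set" assume "A \<in> sets borel"
  then have "W s -` A \<inter> space M \<in> sets (canonical_filtration M W t)"
    unfolding sets_canonical using assms by (intro sigma_sets.Basic) blast
  then show "W s -` A \<inter> space (F t) \<in> sets (F t)"
    unfolding sets_F space_F by (intro sigma_sets.Basic) blast
qed simp

lemma increment_measurable:
  assumes "0 \<le> s" "0 \<le> t"
  shows "(\<lambda>\<omega>. W t \<omega> - W s \<omega>) \<in> borel_measurable M"
  using W_measurable[OF assms(1)] W_measurable[OF assms(2)] by measurable

text \<open>Adding null sets keeps the generator intersection-stable, because subsets of null sets of the
  completion are null.\<close>

lemma indep_increment:
  assumes s: "0 \<le> s" "s < t" and X: "X \<in> borel_measurable (F (ennreal s))"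
  shows "indep_var borel X borel (\<lambda>\<omega>. W t \<omega> - W s \<omega>)"
proof -
  let ?D = "\<lambda>\<omega>. W t \<omega> - W s \<omega>"
  let ?I = "{?D -` A \<inter> space M | A. A \<in> sets borel}"
  let ?C = "sets (canonical_filtration M W (ennreal s))"
  let ?G = "?C \<union> null_sets (completion M)"
  have meas: "?D \<in> borel_measurable M"
    using s by (intro increment_measurable) auto
  have I: "?I \<subseteq> sets M"
    using measurable_sets[OF meas] by blast
  have "base.indep_set ?I ?C"
    using brownian_motion s unfolding brownian_motion_def by blast
  then have indep: "measure M (a \<inter> b) = measure M a * measure M b" if "a \<in> ?I" "b \<in> ?C" for a b
    using that by (rule base.indep_setD)
  have "indep_set ?G ?I"
  proof (rule indep_setI)
    show "?G \<subseteq> sets (completion M)"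
      using sets_canonical_subset by auto
    show "?I \<subseteq> sets (completion M)"
      using I by auto
    fix a b assume a: "a \<in> ?G" and b: "b \<in> ?I"
    then have bM: "b \<in> sets M" using I by auto
    show "prob (a \<inter> b) = prob a * prob b"
    \<comment> \<open>Either \<open>a\<close> is canonical, where independence is part of the
      definition of Brownian motion, or \<open>a\<close> is null and both sides are 0.\<close>
    proof (cases "a \<in> ?C")
      case True
      then have "a \<in> sets M" using sets_canonical_subset by auto
      then show ?thesis
        using indep[OF b True] bM by (simp add: Int_commute mult.commute)
    next
      case False
      with a have n: "a \<in> null_sets (completion M)" by auto
      moreover have "a \<inter> b \<in> null_sets (completion M)"
        using n bM by (intro null_set_Int2) auto
      ultimately show ?thesis by (simp add: measure_eq_0_null_sets)
    qed
  qed
  moreover have "Int_stable ?G"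
  proof (rule Int_stableI)
    fix a b assume a: "a \<in> ?G" and b: "b \<in> ?G"
    have sub: "?G \<subseteq> sets (completion M)"
      using sets_canonical_subset by auto
    show "a \<inter> b \<in> ?G"
      using a b sub by (auto intro: null_set_Int1 null_set_Int2)
  qed
  moreover have "Int_stable ?I"
  proof (rule Int_stableI)
    fix a b assume "a \<in> ?I" "b \<in> ?I"
    then obtain A B where "a = ?D -` A \<inter> space M" "b = ?D -` B \<inter> space M" "A \<in> sets borel" "B \<in> sets borel"
      by auto
    then show "a \<inter> b \<in> ?I"
      by (auto intro!: exI[of _ "A \<inter> B"])
  qed
  ultimately have ind: "indep_set (sigma_sets (space (completion M)) ?G) (sigma_sets (space (completion M)) ?I)"
    by (rule indep_set_sigma_sets)
  show ?thesis
    unfolding indep_var_eq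
  proof (intro conjI)
    show "X \<in> borel_measurable (completion M)"
      using X by (rule measurable_F_completion)
    show "?D \<in> borel_measurable (completion M)"
      using meas by (rule measurable_completion)
    have "{X -` A \<inter> space (completion M) |A. A \<in> sets borel} \<subseteq> sigma_sets (space M) ?G"
      using X unfolding sets_F[symmetric] measurable_def by (auto simp: space_F)
    then have "sigma_sets (space M) {X -` A \<inter> space (completion M) |A. A \<in> sets borel} \<subseteq> sigma_sets (space M) ?G"
      by (rule sigma_sets_mono)
    then show "indep_set (sigma_sets (space (completion M)) {X -` A \<inter> space (completion M) |A. A \<in> sets borel})
        (sigma_sets (space (completion M)) {?D -` A \<inter> space (completion M) |A. A \<in> sets borel})"
      using ind unfolding indep_sets2_eq by (simp add: subset_iff) 
  qed
qed

lemma increment_distributed: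
  assumes "0 \<le> s" "s < t"
  shows "distributed M lborel (\<lambda>\<omega>. W t \<omega> - W s \<omega>) (normal_density 0 (sqrt (t - s)))"
  using brownian_motion assms unfolding brownian_motion_def by blast

lemma increment_square_integrable:
  assumes "0 \<le> s" "s \<le> t"
  shows "square_integrable (completion M) (\<lambda>\<omega>. W t \<omega> - W s \<omega>)"
proof (cases "s = t")
  case False
  then have st: "s < t" using assms by simp
  have [measurable]: "(\<lambda>\<omega>. W t \<omega> - W s \<omega>) \<in> borel_measurable M"
    using assms by (intro increment_measurable) auto
  have "integrable lborel (\<lambda>x. normal_density 0 (sqrt (t - s)) x * x\<^sup>2)"
    using integrable_normal_moment[of "sqrt (t - s)" 0 2] st by simp
  then have "integrable M (\<lambda>\<omega>. (W t \<omega> - W s \<omega>)\<^sup>2)"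
    using distributed_integrable[OF increment_distributed[OF assms(1) st], of "\<lambda>x. x\<^sup>2"] by simp
  then show ?thesis
    by (intro square_integrableI) (auto simp: integrable_completion intro: measurable_completion)
qed (simp add: square_integrable_def)

lemma expectation_increment:
  assumes "0 \<le> s" "s \<le> t"
  shows "expectation (\<lambda>\<omega>. W t \<omega> - W s \<omega>) = 0"
    and "expectation (\<lambda>\<omega>. (W t \<omega> - W s \<omega>)\<^sup>2) = t - s"
proof -
  have [measurable]: "(\<lambda>\<omega>. W t \<omega> - W s \<omega>) \<in> borel_measurable M"
    using assms by (intro increment_measurable) auto
  have "expectation (\<lambda>\<omega>. W t \<omega> - W s \<omega>) = 0 \<and> expectation (\<lambda>\<omega>. (W t \<omega> - W s \<omega>)\<^sup>2) = t - s"
  proof (cases "s = t")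
    case False
    then have st: "s < t" using assms by simp
    \<comment> \<open>The odd normal moment with index 0 is the mean, the even one with index 1 is
      the variance \<open>t - s\<close>.\<close>
    note D = distributed_integral[OF increment_distributed[OF assms(1) st]]
    show ?thesis
      using D[of "\<lambda>x. x"] D[of "\<lambda>x. x\<^sup>2"] integral_normal_moment_odd[of "sqrt (t - s)" 0 0]
        integral_normal_moment_even[of "sqrt (t - s)" 0 1] st
      by (simp add: integral_completion fact_numeral)
  qed simp
  then show "expectation (\<lambda>\<omega>. W t \<omega> - W s \<omega>) = 0"
    and "expectation (\<lambda>\<omega>. (W t \<omega> - W s \<omega>)\<^sup>2) = t - s" by auto
qed

text \<open>Independence factors the expectations. Mere integrability of \<open>Z\<close> is asked
  for because \<open>Z\<close> will be a product of two square-integrable functions, or a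
  square.\<close>

lemma expectation_mult_increment:
  assumes "0 \<le> s" "s \<le> t" and Z: "Z \<in> borel_measurable (F (ennreal s))" "integrable (completion M) Z"
  shows "integrable (completion M) (\<lambda>\<omega>. Z \<omega> * (W t \<omega> - W s \<omega>))"
    and "expectation (\<lambda>\<omega>. Z \<omega> * (W t \<omega> - W s \<omega>)) = 0"
    and "integrable (completion M) (\<lambda>\<omega>. Z \<omega> * (W t \<omega> - W s \<omega>)\<^sup>2)"
    and "expectation (\<lambda>\<omega>. Z \<omega> * (W t \<omega> - W s \<omega>)\<^sup>2) = expectation Z * (t - s)"
proof -
  let ?D = "\<lambda>\<omega>. W t \<omega> - W s \<omega>"
  have sq: "square_integrable (completion M) ?D"
    by (rule increment_square_integrable[OF assms(1,2)])
  have "integrable (completion M) (\<lambda>\<omega>. Z \<omega> * ?D \<omega>) \<and> expectation (\<lambda>\<omega>. Z \<omega> * ?D \<omega>) = 0 \<and>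
      integrable (completion M) (\<lambda>\<omega>. Z \<omega> * (?D \<omega>)\<^sup>2) \<and>
      expectation (\<lambda>\<omega>. Z \<omega> * (?D \<omega>)\<^sup>2) = expectation Z * (t - s)"
  proof (cases "s = t")
    case False
    then have st: "s < t" using assms by simp
    have iv: "indep_var borel Z borel ?D"
      by (rule indep_increment[OF assms(1) st Z(1)])
    have iv2: "indep_var borel Z borel (\<lambda>\<omega>. (?D \<omega>)\<^sup>2)"
      using indep_var_compose[OF iv, of "\<lambda>x. x" borel "\<lambda>x. x\<^sup>2" borel] by (simp add: o_def)
    show ?thesis
      using indep_var_integrable[OF iv Z(2) square_integrable_integrable[OF sq]]
        indep_var_lebesgue_integral[OF iv Z(2) square_integrable_integrable[OF sq]]
        indep_var_integrable[OF iv2 Z(2) square_integrable_square[OF sq]]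
        indep_var_lebesgue_integral[OF iv2 Z(2) square_integrable_square[OF sq]]
        expectation_increment[OF assms(1,2)] by simp
  qed simp
  then show "integrable (completion M) (\<lambda>\<omega>. Z \<omega> * ?D \<omega>)" "expectation (\<lambda>\<omega>. Z \<omega> * ?D \<omega>) = 0"
      "integrable (completion M) (\<lambda>\<omega>. Z \<omega> * (?D \<omega>)\<^sup>2)"
      "expectation (\<lambda>\<omega>. Z \<omega> * (?D \<omega>)\<^sup>2) = expectation Z * (t - s)"
    by auto
qed

end

subsection \<open>Integrals of simple processes\<close>

context brownian
begin

lemma simple_data_Suc: "simple_data F (Suc n) t \<xi> \<Longrightarrow> simple_data F n t \<xi>"
  by (simp add: simple_data_def)

lemma simple_data_mono:
  assumes "simple_data G n t \<xi>" "i \<le> j" "j \<le> n"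
  shows "t i \<le> t j"
  using assms(2,3)
proof (induction j rule: dec_induct)
  case (step j)
  moreover from step have "t j < t (Suc j)"
    using assms(1) by (simp add: simple_data_def)
  ultimately show ?case by simp
qed simp

lemma simple_data_nonneg:
  assumes "simple_data G n t \<xi>" "i \<le> n"
  shows "0 \<le> t i"
  using simple_data_mono[OF assms(1), of 0 i] assms by (simp add: simple_data_def)

lemma simple_data_less: "simple_data G n t \<xi> \<Longrightarrow> i < n \<Longrightarrow> t i < t (Suc i)"
  by (simp add: simple_data_def)

lemma simple_data_measurable:
  "simple_data F n t \<xi> \<Longrightarrow> i < n \<Longrightarrow> \<xi> i \<in> borel_measurable (F (ennreal (t i)))"
  by (simp add: simple_data_def)

lemma simple_data_bounded:
  assumes "simple_data F n t \<xi>" "i < n"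
  obtains B where "\<And>\<omega>. \<omega> \<in> space M \<Longrightarrow> \<bar>\<xi> i \<omega>\<bar> \<le> B"
proof -
  have "bounded (\<xi> i ` space M)"
    using assms unfolding simple_data_def space_F by blast
  then show ?thesis
    using that unfolding bounded_iff by auto
qed

lemma square_integrable_simple_term:
  assumes S: "simple_data F n t \<xi>" "i < n" and "0 \<le> a" "a \<le> b"
  shows "square_integrable (completion M) (\<lambda>\<omega>. \<xi> i \<omega> * (W b \<omega> - W a \<omega>))"
proof -
  obtain B where "\<And>\<omega>. \<omega> \<in> space M \<Longrightarrow> \<bar>\<xi> i \<omega>\<bar> \<le> B"
    using simple_data_bounded[OF S] by blast
  then show ?thesis
    using measurable_F_completion[OF simple_data_measurable[OF S]]
      increment_square_integrable[OF assms(3,4)]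
    by (intro square_integrable_bounded_mult[where B=B]) auto
qed

lemma square_integrable_simple_integral:
  assumes S: "simple_data F n t \<xi>" and s: "0 \<le> s"
  shows "square_integrable (completion M) (simple_integral W n t \<xi> s)"
  unfolding simple_integral_def
proof (rule square_integrable_sum)
  fix i assume "i \<in> {..<n}"
  then show "square_integrable (completion M) (\<lambda>\<omega>. \<xi> i \<omega> * (W (min (t (Suc i)) s) \<omega> - W (min (t i) s) \<omega>))"
    using simple_data_nonneg[OF S, of i] simple_data_less[OF S, of i] s
    by (intro square_integrable_simple_term[OF S]) auto
qed

text \<open>A term with \<open>t i > s\<close> vanishes since both minima are \<open>s\<close>; in
  the other terms the coefficient is already known at time \<open>s\<close>.\<close>

lemma simple_integral_adapted:
  assumes S: "simple_data F n t \<xi>" and s: "0 \<le> s"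
  shows "simple_integral W n t \<xi> s \<in> borel_measurable (F (ennreal s))"
  unfolding simple_integral_def
proof (rule borel_measurable_sum)
  fix i assume i: "i \<in> {..<n}"
  have t: "0 \<le> t i" "t i < t (Suc i)"
    using simple_data_nonneg[OF S, of i] simple_data_less[OF S, of i] i by auto
  show "(\<lambda>\<omega>. \<xi> i \<omega> * (W (min (t (Suc i)) s) \<omega> - W (min (t i) s) \<omega>)) \<in> borel_measurable (F (ennreal s))"
  proof (cases "t i \<le> s")
    case True
    then have "\<xi> i \<in> borel_measurable (F (ennreal s))"
      using simple_data_measurable[OF S, of i] i by (auto intro: measurable_F_mono ennreal_leI)
    moreover have "W (min (t (Suc i)) s) \<in> borel_measurable (F (ennreal s))"
        "W (min (t i) s) \<in> borel_measurable (F (ennreal s))"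
      using t s by (auto intro!: W_adapted ennreal_leI)
    ultimately show ?thesis by measurable
  next
    case False
    then show ?thesis using t by (simp add: min_def)
  qed
qed

text \<open>Clipping the partition points to the interval from \<open>s\<close> to \<open>T\<close>
  turns the difference into a sum over increments that all begin at or after \<open>s\<close>, so
  that an \<open>F s\<close>-measurable factor can be absorbed into the coefficients.\<close>

lemma simple_integral_increment:
  assumes S: "simple_data F n t \<xi>" and s: "0 \<le> s" "s \<le> T"
  shows "simple_integral W n t \<xi> T \<omega> - simple_integral W n t \<xi> s \<omega> =
    (\<Sum>i<n. \<xi> i \<omega> * (W (max s (min (t (Suc i)) T)) \<omega> - W (max s (min (t i) T)) \<omega>))"
proof -
  \<comment> \<open>For \<open>b \<le> s\<close> both sides are 0, otherwise
    \<open>min b s = s\<close>. Used at both endpoints of a term, it makes \<open>W s\<close>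
    cancel.\<close>
  have "W (min b T) \<omega> - W (min b s) \<omega> = W (max s (min b T)) \<omega> - W s \<omega>" for b
    using s by (auto simp: min_def max_def)
  from this[of "t (Suc _)"] this[of "t _"] show ?thesis
    unfolding simple_integral_def sum_subtractf[symmetric] right_diff_distrib[symmetric]
    by (intro sum.cong refl arg_cong2[where f="(*)"]) (smt (verit))
qed

text \<open>In each term the coefficient \<open>\<xi> i * Z\<close> is known at the clipped point
  \<open>a i\<close>, which lies after both \<open>s\<close> and \<open>t i\<close>; the increment
  from \<open>a i\<close> on is centred and independent of it. If \<open>t i > T\<close>, the two
  clipped points coincide and the term is 0.\<close>

lemma expectation_mult_simple_increment:
  assumes S: "simple_data F n t \<xi>" and s: "0 \<le> s" "s \<le> T"
    and Z: "Z \<in> borel_measurable (F (ennreal s))" "square_integrable (completion M) Z"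
  shows "expectation (\<lambda>\<omega>. Z \<omega> * (simple_integral W n t \<xi> T \<omega> - simple_integral W n t \<xi> s \<omega>)) = 0"
proof -
  define a where "a i = max s (min (t i) T)" for i
  have summand: "integrable (completion M) (\<lambda>\<omega>. Z \<omega> * (\<xi> i \<omega> * (W (a (Suc i)) \<omega> - W (a i) \<omega>))) \<and>
      expectation (\<lambda>\<omega>. Z \<omega> * (\<xi> i \<omega> * (W (a (Suc i)) \<omega> - W (a i) \<omega>))) = 0" if i: "i < n" for i
  proof (cases "t i \<le> T")
    case True
    have a: "0 \<le> a i" "a i \<le> a (Suc i)" "s \<le> a i" "t i \<le> a i"
      using s True simple_data_less[OF S i] by (auto simp: a_def)
    obtain B where B: "\<And>\<omega>. \<omega> \<in> space M \<Longrightarrow> \<bar>\<xi> i \<omega>\<bar> \<le> B"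
      using simple_data_bounded[OF S i] by blast
    have "\<xi> i \<in> borel_measurable (F (ennreal (a i)))"
      using simple_data_measurable[OF S i] a by (auto intro: measurable_F_mono ennreal_leI)
    moreover have "Z \<in> borel_measurable (F (ennreal (a i)))"
      using Z(1) a by (auto intro: measurable_F_mono ennreal_leI)
    ultimately have m: "(\<lambda>\<omega>. \<xi> i \<omega> * Z \<omega>) \<in> borel_measurable (F (ennreal (a i)))"
      by measurable
    have "integrable (completion M) (\<lambda>\<omega>. \<xi> i \<omega> * Z \<omega>)"
      using measurable_F_completion[OF simple_data_measurable[OF S i]] Z(2) B
      by (intro square_integrable_integrable square_integrable_bounded_mult[where B=B]) auto
    from expectation_mult_increment(1,2)[OF a(1,2) m this] show ?thesis
      by (simp add: mult_ac)
  next
    case False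
    then show ?thesis
      using simple_data_less[OF S i] by (simp add: a_def min_def)
  qed
  have "expectation (\<lambda>\<omega>. Z \<omega> * (simple_integral W n t \<xi> T \<omega> - simple_integral W n t \<xi> s \<omega>)) =
      expectation (\<lambda>\<omega>. \<Sum>i<n. Z \<omega> * (\<xi> i \<omega> * (W (a (Suc i)) \<omega> - W (a i) \<omega>)))"
    by (simp add: simple_integral_increment[OF S s] a_def sum_distrib_left)
  also have "\<dots> = 0"
    using summand by (subst Bochner_Integration.integral_sum) auto
  finally show ?thesis .
qed

text \<open>The half of the Ito isometry that is needed. Induction adds the last term, which is
  orthogonal to the earlier ones. An inequality arises because stopping at \<open>s\<close> shortens
  intervals, while the right-hand side keeps their full lengths so as to match the energy over the
  whole half-line.\<close>

lemma expectation_simple_integral_power2_le: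
  assumes "simple_data F n t \<xi>" and s: "0 \<le> s"
  shows "expectation (\<lambda>\<omega>. (simple_integral W n t \<xi> s \<omega>)\<^sup>2)
    \<le> (\<Sum>i<n. expectation (\<lambda>\<omega>. (\<xi> i \<omega>)\<^sup>2) * (t (Suc i) - t i))"
  using assms(1)
proof (induction n)
  case 0
  then show ?case by (simp add: simple_integral_def)
next
  case (Suc n)
  note S = Suc.prems
  note S' = simple_data_Suc[OF S]
  let ?X = "simple_integral W n t \<xi> s"
  define a b where "a = min (t n) s" and "b = min (t (Suc n)) s"
  let ?D = "\<lambda>\<omega>. W b \<omega> - W a \<omega>"
  have t: "0 \<le> t n" "t n < t (Suc n)"
    using simple_data_nonneg[OF S, of n] simple_data_less[OF S, of n] by auto
  have ab: "0 \<le> a" "a \<le> b" "b - a \<le> t (Suc n) - t n"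
    using t s by (auto simp: a_def b_def)
  obtain B where B: "\<And>\<omega>. \<omega> \<in> space M \<Longrightarrow> \<bar>\<xi> n \<omega>\<bar> \<le> B"
    using simple_data_bounded[OF S lessI] by blast
  have sqX: "square_integrable (completion M) ?X"
    by (rule square_integrable_simple_integral[OF S' s])
  have sqY: "square_integrable (completion M) (\<lambda>\<omega>. \<xi> n \<omega> * ?D \<omega>)"
    by (rule square_integrable_simple_term[OF S lessI ab(1,2)])
  have \<xi>N: "\<xi> n \<in> borel_measurable (completion M)"
    by (rule measurable_F_completion[OF simple_data_measurable[OF S lessI]])
  have sq\<xi>: "square_integrable (completion M) (\<xi> n)"
    using square_integrable_bounded_mult[OF \<xi>N, of "\<lambda>_. 1" B] B by (simp add: square_integrable_def)
  have cross: "expectation (\<lambda>\<omega>. ?X \<omega> * (\<xi> n \<omega> * ?D \<omega>)) = 0"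
    and sq: "expectation (\<lambda>\<omega>. (\<xi> n \<omega> * ?D \<omega>)\<^sup>2) \<le> expectation (\<lambda>\<omega>. (\<xi> n \<omega>)\<^sup>2) * (t (Suc n) - t n)"
  proof -
    have "expectation (\<lambda>\<omega>. ?X \<omega> * (\<xi> n \<omega> * ?D \<omega>)) = 0 \<and>
      expectation (\<lambda>\<omega>. (\<xi> n \<omega> * ?D \<omega>)\<^sup>2) \<le> expectation (\<lambda>\<omega>. (\<xi> n \<omega>)\<^sup>2) * (t (Suc n) - t n)"
    proof (cases "t n \<le> s")
      case True
      then have a: "a = t n" by (simp add: a_def)
      have \<xi>F: "\<xi> n \<in> borel_measurable (F (ennreal a))"
        unfolding a by (rule simple_data_measurable[OF S lessI])
      \<comment> \<open>All earlier partition points are at most \<open>t n\<close>, which is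
        \<open>a\<close>, so the earlier part of the integral does not change after \<open>a\<close>
        and is known there. This permits \<open>\<xi> n * ?X\<close> as the factor in front of the
        last increment.\<close>
      have X_eq: "?X \<omega> = simple_integral W n t \<xi> a \<omega>" for \<omega>
        unfolding simple_integral_def
      proof (intro sum.cong refl)
        fix i assume "i \<in> {..<n}"
        then have "t i \<le> t n" "t (Suc i) \<le> t n"
          using simple_data_mono[OF S, of i n] simple_data_mono[OF S, of "Suc i" n] by auto
        then show "\<xi> i \<omega> * (W (min (t (Suc i)) s) \<omega> - W (min (t i) s) \<omega>) =
            \<xi> i \<omega> * (W (min (t (Suc i)) a) \<omega> - W (min (t i) a) \<omega>)"
          using True by (simp add: a min_def)
      qed
      then have "?X \<in> borel_measurable (F (ennreal a))"
        using simple_integral_adapted[OF S' ab(1)] by (simp add: X_eq[abs_def])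
      then have m1: "(\<lambda>\<omega>. \<xi> n \<omega> * ?X \<omega>) \<in> borel_measurable (F (ennreal a))"
        using \<xi>F by measurable
      have i1: "integrable (completion M) (\<lambda>\<omega>. \<xi> n \<omega> * ?X \<omega>)"
        by (rule square_integrable_mult[OF sq\<xi> sqX])
      have m2: "(\<lambda>\<omega>. (\<xi> n \<omega>)\<^sup>2) \<in> borel_measurable (F (ennreal a))"
        using \<xi>F by measurable
      have "expectation (\<lambda>\<omega>. (\<xi> n \<omega>)\<^sup>2) * (b - a) \<le> expectation (\<lambda>\<omega>. (\<xi> n \<omega>)\<^sup>2) * (t (Suc n) - t n)"
        using ab by (intro mult_left_mono) auto
      then show ?thesis
        using expectation_mult_increment(2)[OF ab(1,2) m1 i1]
          expectation_mult_increment(4)[OF ab(1,2) m2 square_integrable_square[OF sq\<xi>]]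
        by (simp add: mult_ac power_mult_distrib)
    next
      case False
      then have "a = b" using t by (simp add: a_def b_def)
      then show ?thesis using t by simp
    qed
    then show "expectation (\<lambda>\<omega>. ?X \<omega> * (\<xi> n \<omega> * ?D \<omega>)) = 0"
        "expectation (\<lambda>\<omega>. (\<xi> n \<omega> * ?D \<omega>)\<^sup>2) \<le> expectation (\<lambda>\<omega>. (\<xi> n \<omega>)\<^sup>2) * (t (Suc n) - t n)"
      by auto
  qed
  have "expectation (\<lambda>\<omega>. (simple_integral W (Suc n) t \<xi> s \<omega>)\<^sup>2) =
      expectation (\<lambda>\<omega>. (?X \<omega>)\<^sup>2 + (\<xi> n \<omega> * ?D \<omega>)\<^sup>2 + 2 * (?X \<omega> * (\<xi> n \<omega> * ?D \<omega>)))"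
    by (simp add: simple_integral_def a_def b_def power2_sum mult.assoc)
  also have "\<dots> = expectation (\<lambda>\<omega>. (?X \<omega>)\<^sup>2) + expectation (\<lambda>\<omega>. (\<xi> n \<omega> * ?D \<omega>)\<^sup>2)
      + 2 * expectation (\<lambda>\<omega>. ?X \<omega> * (\<xi> n \<omega> * ?D \<omega>))"
    using square_integrable_square[OF sqX] square_integrable_square[OF sqY] square_integrable_mult[OF sqX sqY]
    by (simp only: Bochner_Integration.integral_add Bochner_Integration.integrable_add
        integral_mult_right_zero integrable_mult_right)
  finally show ?case
    using Suc.IH[OF S'] cross sq by simp
qed

text \<open>The half-open intervals are disjoint, so no cross terms survive. The induction runs over
  initial segments \<open>m \<le> n\<close>: before the interval with index \<open>m\<close> all
  previous ones have ended.\<close>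

lemma simple_process_power2:
  assumes "simple_data G n t \<xi>"
  shows "(simple_process n t \<xi> s \<omega>)\<^sup>2 = (\<Sum>i<n. (\<xi> i \<omega>)\<^sup>2 * indicator {t i<..t (Suc i)} s)"
proof -
  have "(simple_process m t \<xi> s \<omega>)\<^sup>2 = (\<Sum>i<m. (\<xi> i \<omega>)\<^sup>2 * indicator {t i<..t (Suc i)} s)" if "m \<le> n" for m
    using that
  proof (induction m)
    case (Suc m)
    have "simple_process m t \<xi> s \<omega> = 0" if "t m < s"
      unfolding simple_process_def
    proof (rule sum.neutral, rule ballI)
      fix i assume "i \<in> {..<m}"
      then have "t (Suc i) < s"
        using simple_data_mono[OF assms, of "Suc i" m] Suc.prems that by auto
      then show "\<xi> i \<omega> * indicator {t i<..t (Suc i)} s = 0" by simp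
    qed
    then have "simple_process m t \<xi> s \<omega> * (\<xi> m \<omega> * indicator {t m<..t (Suc m)} s) = 0"
      by (auto split: split_indicator)
    moreover have "simple_process (Suc m) t \<xi> s \<omega> =
        simple_process m t \<xi> s \<omega> + \<xi> m \<omega> * indicator {t m<..t (Suc m)} s"
      by (simp add: simple_process_def)
    ultimately have "(simple_process (Suc m) t \<xi> s \<omega>)\<^sup>2 =
        (simple_process m t \<xi> s \<omega>)\<^sup>2 + (\<xi> m \<omega> * indicator {t m<..t (Suc m)} s)\<^sup>2"
      by (simp add: power2_sum)
    then show ?case
      using Suc by (simp add: power_mult_distrib indicator_def)
  qed (simp add: simple_process_def)
  then show ?thesis by simp
qed

text \<open>The same sum as in the bound on the second moment of the simple integral; together the
  two show that simple integration does not increase the \<open>L^2\<close> norm, at any time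
  \<open>s\<close>.\<close>

lemma energy_simple_process:
  assumes S: "simple_data F n t \<xi>"
  shows "energy (completion M) (simple_process n t \<xi>) =
    ennreal (\<Sum>i<n. expectation (\<lambda>\<omega>. (\<xi> i \<omega>)\<^sup>2) * (t (Suc i) - t i))"
proof -
  have \<xi>: "\<xi> i \<in> borel_measurable (completion M)" if "i < n" for i
    by (rule measurable_F_completion[OF simple_data_measurable[OF S that]])
  have inner: "(\<integral>\<^sup>+s\<in>{0..}. ennreal ((simple_process n t \<xi> s \<omega>)\<^sup>2) \<partial>lborel) =
      (\<Sum>i<n. ennreal ((\<xi> i \<omega>)\<^sup>2) * ennreal (t (Suc i) - t i))" for \<omega>
  proof -
    have "(\<integral>\<^sup>+s\<in>{0..}. ennreal ((simple_process n t \<xi> s \<omega>)\<^sup>2) \<partial>lborel) =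
        (\<integral>\<^sup>+s. (\<Sum>i<n. ennreal ((\<xi> i \<omega>)\<^sup>2) * indicator {t i<..t (Suc i)} s) \<partial>lborel)"
    proof (intro nn_integral_cong)
      fix s :: real
      have "ennreal ((simple_process n t \<xi> s \<omega>)\<^sup>2) = (\<Sum>i<n. ennreal ((\<xi> i \<omega>)\<^sup>2) * indicator {t i<..t (Suc i)} s)"
      proof -
        have "ennreal ((simple_process n t \<xi> s \<omega>)\<^sup>2) =
            (\<Sum>i<n. ennreal ((\<xi> i \<omega>)\<^sup>2 * indicator {t i<..t (Suc i)} s))"
          unfolding simple_process_power2[OF S] by (rule sum_ennreal[symmetric]) simp
        also have "\<dots> = (\<Sum>i<n. ennreal ((\<xi> i \<omega>)\<^sup>2) * indicator {t i<..t (Suc i)} s)"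
          by (intro sum.cong refl) (simp split: split_indicator)
        finally show ?thesis .
      qed
      moreover have "(\<Sum>i<n. ennreal ((\<xi> i \<omega>)\<^sup>2) * indicator {t i<..t (Suc i)} s) = 0" if "s < 0"
      proof (rule sum.neutral, rule ballI)
        fix i assume "i \<in> {..<n}"
        then show "ennreal ((\<xi> i \<omega>)\<^sup>2) * indicator {t i<..t (Suc i)} s = 0"
          using simple_data_nonneg[OF S, of i] that by (simp add: indicator_def)
      qed
      ultimately show "ennreal ((simple_process n t \<xi> s \<omega>)\<^sup>2) * indicator {0..} s =
          (\<Sum>i<n. ennreal ((\<xi> i \<omega>)\<^sup>2) * indicator {t i<..t (Suc i)} s)"
        by (cases "0 \<le> s") auto
    qed
    also have "\<dots> = (\<Sum>i<n. \<integral>\<^sup>+s. ennreal ((\<xi> i \<omega>)\<^sup>2) * indicator {t i<..t (Suc i)} s \<partial>lborel)"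
      by (rule nn_integral_sum) simp
    also have "\<dots> = (\<Sum>i<n. ennreal ((\<xi> i \<omega>)\<^sup>2) * ennreal (t (Suc i) - t i))"
      using simple_data_less[OF S] by (intro sum.cong refl) (simp add: nn_integral_cmult_indicator less_imp_le)
    finally show ?thesis .
  qed
  have sq\<xi>: "integrable (completion M) (\<lambda>\<omega>. (\<xi> i \<omega>)\<^sup>2)" if i: "i < n" for i
  proof -
    obtain B where "\<And>\<omega>. \<omega> \<in> space M \<Longrightarrow> \<bar>\<xi> i \<omega>\<bar> \<le> B"
      using simple_data_bounded[OF S i] by blast
    then show ?thesis
      using square_integrable_bounded_mult[OF \<xi>[OF i], of "\<lambda>_. 1" B] by (simp add: square_integrable_def)
  qed
  have "energy (completion M) (simple_process n t \<xi>) =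
      (\<integral>\<^sup>+\<omega>. (\<Sum>i<n. ennreal ((\<xi> i \<omega>)\<^sup>2) * ennreal (t (Suc i) - t i)) \<partial>completion M)"
    unfolding energy_def inner ..
  also have "\<dots> = (\<Sum>i<n. \<integral>\<^sup>+\<omega>. ennreal ((\<xi> i \<omega>)\<^sup>2) * ennreal (t (Suc i) - t i) \<partial>completion M)"
    using \<xi> by (intro nn_integral_sum) (auto intro!: borel_measurable_times_ennreal)
  also have "\<dots> = (\<Sum>i<n. ennreal (expectation (\<lambda>\<omega>. (\<xi> i \<omega>)\<^sup>2) * (t (Suc i) - t i)))"
  proof (intro sum.cong refl)
    fix i assume "i \<in> {..<n}"
    then have i: "i < n" by simp
    show "(\<integral>\<^sup>+\<omega>. ennreal ((\<xi> i \<omega>)\<^sup>2) * ennreal (t (Suc i) - t i) \<partial>completion M) =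
        ennreal (expectation (\<lambda>\<omega>. (\<xi> i \<omega>)\<^sup>2) * (t (Suc i) - t i))"
      using \<xi>[OF i] sq\<xi>[OF i] simple_data_less[OF S i]
      by (subst nn_integral_multc) (auto simp: nn_integral_eq_integral ennreal_mult)
  qed
  also have "\<dots> = ennreal (\<Sum>i<n. expectation (\<lambda>\<omega>. (\<xi> i \<omega>)\<^sup>2) * (t (Suc i) - t i))"
    using simple_data_less[OF S] by (intro sum_ennreal) (auto intro!: mult_nonneg_nonneg simp: less_imp_le)
  finally show ?thesis .
qed

lemma nn_integral_simple_integral_power2_le:
  assumes S: "simple_data F n t \<xi>" and s: "0 \<le> s"
  shows "(\<integral>\<^sup>+\<omega>. ennreal ((simple_integral W n t \<xi> s \<omega>)\<^sup>2) \<partial>completion M)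
    \<le> energy (completion M) (simple_process n t \<xi>)"
proof -
  have "(\<integral>\<^sup>+\<omega>. ennreal ((simple_integral W n t \<xi> s \<omega>)\<^sup>2) \<partial>completion M) =
      ennreal (expectation (\<lambda>\<omega>. (simple_integral W n t \<xi> s \<omega>)\<^sup>2))"
    by (rule nn_integral_eq_integral[OF square_integrable_square[OF square_integrable_simple_integral[OF S s]]]) simp
  also have "\<dots> \<le> energy (completion M) (simple_process n t \<xi>)"
    unfolding energy_simple_process[OF S]
    by (rule ennreal_leI[OF expectation_simple_integral_power2_le[OF S s]])
  finally show ?thesis .
qed

end

subsection \<open>The Ito integral\<close>

text \<open>Allows a process to be altered at negative times, where nothing is known about its
  measurability.\<close>

lemma energy_cong:
  assumes "\<And>s \<omega>. 0 \<le> s \<Longrightarrow> \<omega> \<in> space M \<Longrightarrow> X s \<omega> = Y s \<omega>"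
  shows "energy M X = energy M Y"
  unfolding energy_def using assms
  by (auto intro!: nn_integral_cong split: split_indicator)

text \<open>Joint measurability makes the inner time integrals measurable in
  \<open>\<omega>\<close>, without which the outer integral could not be split.\<close>

lemma energy_add_le:
  fixes X Y :: "real \<Rightarrow> 'a \<Rightarrow> real"
  assumes [measurable]: "(\<lambda>(\<omega>, s). X s \<omega>) \<in> borel_measurable (M \<Otimes>\<^sub>M lborel)"
    "(\<lambda>(\<omega>, s). Y s \<omega>) \<in> borel_measurable (M \<Otimes>\<^sub>M lborel)"
  shows "energy M (\<lambda>s \<omega>. X s \<omega> + Y s \<omega>) \<le> 2 * energy M X + 2 * energy M Y"
proof -
  let ?E = "\<lambda>Z \<omega>. \<integral>\<^sup>+s\<in>{0..}. ennreal ((Z s \<omega>)\<^sup>2) \<partial>lborel"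
  have m: "?E Z \<in> borel_measurable M"
    if [measurable]: "(\<lambda>(\<omega>, s). Z s \<omega>) \<in> borel_measurable (M \<Otimes>\<^sub>M lborel)" for Z :: "real \<Rightarrow> 'a \<Rightarrow> real"
    by measurable
  have "?E (\<lambda>s \<omega>. X s \<omega> + Y s \<omega>) \<omega> \<le> 2 * ?E X \<omega> + 2 * ?E Y \<omega>" if [measurable]: "\<omega> \<in> space M" for \<omega>
  proof -
    have [measurable]: "(\<lambda>s. X s \<omega>) \<in> borel_measurable borel" "(\<lambda>s. Y s \<omega>) \<in> borel_measurable borel"
      using measurable_Pair2[OF assms(1) that] measurable_Pair2[OF assms(2) that] by simp_all
    have "?E (\<lambda>s \<omega>. X s \<omega> + Y s \<omega>) \<omega> \<le>
        (\<integral>\<^sup>+s. 2 * (ennreal ((X s \<omega>)\<^sup>2) * indicator {0..} s) + 2 * (ennreal ((Y s \<omega>)\<^sup>2) * indicator {0..} s) \<partial>lborel)"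
      using ennreal_power2_add_le by (intro nn_integral_mono) (simp split: split_indicator)
    also have "\<dots> = 2 * ?E X \<omega> + 2 * ?E Y \<omega>"
      by (subst nn_integral_add) (simp_all add: nn_integral_cmult)
    finally show ?thesis .
  qed
  then have "energy M (\<lambda>s \<omega>. X s \<omega> + Y s \<omega>) \<le> (\<integral>\<^sup>+\<omega>. 2 * ?E X \<omega> + 2 * ?E Y \<omega> \<partial>M)"
    unfolding energy_def by (intro nn_integral_mono)
  also have "\<dots> = 2 * energy M X + 2 * energy M Y"
    using m[OF assms(1)] m[OF assms(2)]
    by (subst nn_integral_add) (simp_all add: nn_integral_cmult energy_def)
  finally show ?thesis .
qed

context brownian
begin

text \<open>Progressive measurability speaks of one bounded time interval at a time. Clamping the
  time to the interval from 0 to \<open>n\<close> gives a function that is measurable on the whole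
  product, and at each point these functions are eventually constant in \<open>n\<close>.\<close>

lemma progressively_measurable_clamp:
  assumes "progressively_measurable F \<alpha>"
  shows "(\<lambda>(\<omega>, s). \<alpha> (max 0 s) \<omega>) \<in> borel_measurable (completion M \<Otimes>\<^sub>M lborel)"
proof (rule borel_measurable_LIMSEQ_real)
  fix n :: nat
  let ?N = "completion M \<Otimes>\<^sub>M (lborel :: real measure)"
  let ?c = "\<lambda>p. max 0 (min (snd p) (real n))"
  \<comment> \<open>\<open>F\<close> at time \<open>n\<close> is coarser than the completion, so the
    identity is measurable from the finer to the coarser space.\<close>
  have id: "(\<lambda>\<omega>. \<omega>) \<in> completion M \<rightarrow>\<^sub>M F (ennreal (real n))"
    by (rule measurable_F_completion[OF measurable_ident_sets[OF refl]])
  have "?c \<in> ?N \<rightarrow>\<^sub>M restrict_space borel {0..real n}"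
    by (rule measurable_restrict_space2) auto
  moreover have "fst \<in> ?N \<rightarrow>\<^sub>M F (ennreal (real n))"
    using measurable_compose[OF measurable_fst id] .
  ultimately have "(\<lambda>p. (?c p, fst p)) \<in> ?N \<rightarrow>\<^sub>M restrict_space borel {0..real n} \<Otimes>\<^sub>M F (ennreal (real n))"
    by (rule measurable_Pair)
  moreover have "(\<lambda>(s, \<omega>). \<alpha> s \<omega>) \<in> borel_measurable (restrict_space borel {0..real n} \<Otimes>\<^sub>M F (ennreal (real n)))"
    using assms unfolding progressively_measurable_def by auto
  ultimately show "(\<lambda>p. \<alpha> (?c p) (fst p)) \<in> borel_measurable ?N"
    using measurable_compose by fastforce
next
  fix p :: "'a \<times> real"
  obtain n0 where n0: "snd p \<le> real n0"
    using real_arch_simple by blast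
  have "eventually (\<lambda>n. \<alpha> (max 0 (min (snd p) (real n))) (fst p) = (case p of (\<omega>, s) \<Rightarrow> \<alpha> (max 0 s) \<omega>)) sequentially"
    using eventually_ge_at_top[of n0]
  proof eventually_elim
    case (elim n)
    then have "min (snd p) (real n) = snd p" using n0 by simp
    then show ?case by (simp add: case_prod_beta)
  qed
  then show "(\<lambda>n. \<alpha> (max 0 (min (snd p) (real n))) (fst p)) \<longlonglongrightarrow> (case p of (\<omega>, s) \<Rightarrow> \<alpha> (max 0 s) \<omega>)"
    by (rule tendsto_eventually)
qed

lemma simple_process_measurable:
  assumes "simple_data F n t \<xi>"
  shows "(\<lambda>(\<omega>, s). simple_process n t \<xi> s \<omega>) \<in> borel_measurable (completion M \<Otimes>\<^sub>M lborel)"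
  unfolding simple_process_def case_prod_beta
proof (rule borel_measurable_sum)
  fix i assume "i \<in> {..<n}"
  then have [measurable]: "\<xi> i \<in> borel_measurable (completion M)"
    using measurable_F_completion[OF simple_data_measurable[OF assms]] by simp
  show "(\<lambda>p. \<xi> i (fst p) * indicator {t i<..t (Suc i)} (snd p)) \<in> borel_measurable (completion M \<Otimes>\<^sub>M lborel)"
    by measurable
qed

text \<open>Triangle inequality for the simple process as the sum of its error and
  \<open>\<alpha>\<close>, carried out with the clamped \<open>\<alpha>\<close>, which is jointly
  measurable and has the same energy.\<close>

lemma energy_simple_process_le:
  assumes S: "simple_data F n t \<xi>" and \<alpha>: "progressively_measurable F \<alpha>"
  shows "energy (completion M) (simple_process n t \<xi>)
    \<le> 2 * energy (completion M) (\<lambda>s \<omega>. simple_process n t \<xi> s \<omega> - \<alpha> s \<omega>) + 2 * energy (completion M) \<alpha>"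
proof -
  let ?\<beta> = "\<lambda>s \<omega>. \<alpha> (max 0 s) \<omega>"
  let ?S = "simple_process n t \<xi>"
  note [measurable] = progressively_measurable_clamp[OF \<alpha>] simple_process_measurable[OF S]
  have "(\<lambda>(\<omega>, s). ?S s \<omega> - ?\<beta> s \<omega>) \<in> borel_measurable (completion M \<Otimes>\<^sub>M lborel)"
    using borel_measurable_diff[OF simple_process_measurable[OF S] progressively_measurable_clamp[OF \<alpha>]]
    by (simp add: case_prod_beta)
  from energy_add_le[OF this progressively_measurable_clamp[OF \<alpha>]]
  have "energy (completion M) ?S \<le>
      2 * energy (completion M) (\<lambda>s \<omega>. ?S s \<omega> - ?\<beta> s \<omega>) + 2 * energy (completion M) ?\<beta>"
    by simp
  moreover have "energy (completion M) (\<lambda>s \<omega>. ?S s \<omega> - ?\<beta> s \<omega>) = energy (completion M) (\<lambda>s \<omega>. ?S s \<omega> - \<alpha> s \<omega>)"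
    by (rule energy_cong) simp
  moreover have "energy (completion M) ?\<beta> = energy (completion M) \<alpha>"
    by (rule energy_cong) simp
  ultimately show ?thesis by simp
qed

end

section \<open>The Ito integral as an \<open>L^2\<close>-bounded martingale\<close>

locale ito_process = brownian M W x
  for M :: "'a measure" and W :: "real \<Rightarrow> 'a \<Rightarrow> real" and x :: real +
  fixes \<alpha> I :: "real \<Rightarrow> 'a \<Rightarrow> real"
  assumes ito: "has_ito_integral (completion M) F W \<alpha> I"
begin

lemma ito_adapted: "0 \<le> t \<Longrightarrow> I t \<in> borel_measurable (F (ennreal t))"
  using ito unfolding has_ito_integral_def by blast

lemma ito_measurable: "0 \<le> t \<Longrightarrow> I t \<in> borel_measurable (completion M)"
  by (rule measurable_F_completion[OF ito_adapted])

lemma ito_continuous: "\<omega> \<in> space M \<Longrightarrow> continuous_on {0..} (\<lambda>t. I t \<omega>)"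
  using ito unfolding has_ito_integral_def by simp

lemma ito_approximation:
  obtains n t \<xi> where "\<And>k. simple_data F (n k) (t k) (\<xi> k)"
    "(\<lambda>k. energy (completion M) (\<lambda>s \<omega>. simple_process (n k) (t k) (\<xi> k) s \<omega> - \<alpha> s \<omega>)) \<longlonglongrightarrow> 0"
    "\<And>s. 0 \<le> s \<Longrightarrow> (\<lambda>k. \<integral>\<^sup>+\<omega>. ennreal ((simple_integral W (n k) (t k) (\<xi> k) s \<omega> - I s \<omega>)\<^sup>2) \<partial>completion M) \<longlonglongrightarrow> 0"
  using ito unfolding has_ito_integral_def by blast

text \<open>A single approximant at finite \<open>L^2\<close> distance suffices: \<open>I s\<close>
  is that approximant minus the error.\<close>

lemma ito_square_integrable:
  assumes s: "0 \<le> s"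
  shows "square_integrable (completion M) (I s)"
proof -
  obtain n t \<xi> where S: "\<And>k. simple_data F (n k) (t k) (\<xi> k)"
    and lim: "\<And>s. 0 \<le> s \<Longrightarrow> (\<lambda>k. \<integral>\<^sup>+\<omega>. ennreal ((simple_integral W (n k) (t k) (\<xi> k) s \<omega> - I s \<omega>)\<^sup>2) \<partial>completion M) \<longlonglongrightarrow> 0"
    by (rule ito_approximation) blast
  have "eventually (\<lambda>k. (\<integral>\<^sup>+\<omega>. ennreal ((simple_integral W (n k) (t k) (\<xi> k) s \<omega> - I s \<omega>)\<^sup>2) \<partial>completion M) < 1) sequentially"
    by (rule order_tendstoD(2)[OF lim[OF s]]) simp
  then obtain k where k: "(\<integral>\<^sup>+\<omega>. ennreal ((simple_integral W (n k) (t k) (\<xi> k) s \<omega> - I s \<omega>)\<^sup>2) \<partial>completion M) < 1"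
    by (auto simp: eventually_sequentially)
  have sqS: "square_integrable (completion M) (simple_integral W (n k) (t k) (\<xi> k) s)"
    by (rule square_integrable_simple_integral[OF S s])
  have "square_integrable (completion M) (\<lambda>\<omega>. simple_integral W (n k) (t k) (\<xi> k) s \<omega> - I s \<omega>)"
    using square_integrable_measurable[OF sqS] ito_measurable[OF s] less_trans[OF k]
    by (intro square_integrable_nn borel_measurable_diff) auto
  from square_integrable_diff[OF sqS this] show ?thesis by simp
qed

text \<open>Simple integrals vanish at time 0, so the approximation errors there form the constant
  sequence \<open>E[I_0^2]\<close>, whose limit is 0.\<close>

lemma ito_zero: "AE \<omega> in completion M. I 0 \<omega> = 0"
proof -
  obtain n t \<xi> where S: "\<And>k. simple_data F (n k) (t k) (\<xi> k)"
    and lim: "\<And>s. 0 \<le> s \<Longrightarrow> (\<lambda>k. \<integral>\<^sup>+\<omega>. ennreal ((simple_integral W (n k) (t k) (\<xi> k) s \<omega> - I s \<omega>)\<^sup>2) \<partial>completion M) \<longlonglongrightarrow> 0"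
    by (rule ito_approximation) blast
  have "simple_integral W (n k) (t k) (\<xi> k) 0 \<omega> = 0" for k \<omega>
    unfolding simple_integral_def
  proof (rule sum.neutral, rule ballI)
    fix i assume "i \<in> {..<n k}"
    then have "0 \<le> t k i" "0 \<le> t k (Suc i)"
      using simple_data_nonneg[OF S, of i k] simple_data_nonneg[OF S, of "Suc i" k] by auto
    then show "\<xi> k i \<omega> * (W (min (t k (Suc i)) 0) \<omega> - W (min (t k i) 0) \<omega>) = 0"
      by (simp add: min_def)
  qed
  then have "(\<lambda>k::nat. \<integral>\<^sup>+\<omega>. ennreal ((I 0 \<omega>)\<^sup>2) \<partial>completion M) \<longlonglongrightarrow> 0"
    using lim[of 0] by simp
  then have "(\<integral>\<^sup>+\<omega>. ennreal ((I 0 \<omega>)\<^sup>2) \<partial>completion M) = 0"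
    by (simp add: LIMSEQ_const_iff)
  moreover have "(\<lambda>\<omega>. ennreal ((I 0 \<omega>)\<^sup>2)) \<in> borel_measurable (completion M)"
    using ito_measurable[of 0] by measurable
  ultimately show ?thesis
    by (simp add: nn_integral_0_iff_AE)
qed

text \<open>The martingale property in tested form, without conditional expectations. It is exact
  for simple integrals, so the defect \<open>?c\<close> is the pairing of \<open>Z\<close> with the
  approximation errors at \<open>s\<close> and \<open>T\<close>.\<close>

lemma ito_martingale:
  assumes s: "0 \<le> s" "s \<le> T"
    and Z: "Z \<in> borel_measurable (F (ennreal s))" "square_integrable (completion M) Z"
  shows "expectation (\<lambda>\<omega>. Z \<omega> * (I T \<omega> - I s \<omega>)) = 0"
proof -
  obtain n t \<xi> where S: "\<And>k. simple_data F (n k) (t k) (\<xi> k)"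
    and lim: "\<And>s. 0 \<le> s \<Longrightarrow> (\<lambda>k. \<integral>\<^sup>+\<omega>. ennreal ((simple_integral W (n k) (t k) (\<xi> k) s \<omega> - I s \<omega>)\<^sup>2) \<partial>completion M) \<longlonglongrightarrow> 0"
    by (rule ito_approximation) blast
  let ?S = "\<lambda>k. simple_integral W (n k) (t k) (\<xi> k)"
  let ?e = "\<lambda>k s. \<integral>\<^sup>+\<omega>. ennreal ((?S k s \<omega> - I s \<omega>)\<^sup>2) \<partial>completion M"
  let ?K = "\<integral>\<^sup>+\<omega>. ennreal ((Z \<omega>)\<^sup>2) \<partial>completion M"
  let ?c = "expectation (\<lambda>\<omega>. Z \<omega> * (I T \<omega> - I s \<omega>))"
  have T: "0 \<le> T" using s by simp
  have sqS: "square_integrable (completion M) (?S k r)" if "0 \<le> r" for k r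
    by (rule square_integrable_simple_integral[OF S that])
  note sqI = ito_square_integrable
  have "ennreal (?c\<^sup>2) \<le> ?K * (2 * ?e k s + 2 * ?e k T)" for k
  proof -
    \<comment> \<open>The increment of \<open>I\<close> minus that of the simple integral, regrouped
      into one error at \<open>s\<close> and one at \<open>T\<close>.\<close>
    let ?D = "\<lambda>\<omega>. (?S k s \<omega> - I s \<omega>) + (I T \<omega> - ?S k T \<omega>)"
    have sqD: "square_integrable (completion M) ?D"
      by (intro square_integrable_add square_integrable_diff sqS sqI s T)
    have "expectation (\<lambda>\<omega>. Z \<omega> * ?D \<omega>) =
        expectation (\<lambda>\<omega>. Z \<omega> * (I T \<omega> - I s \<omega>) - Z \<omega> * (?S k T \<omega> - ?S k s \<omega>))"
      by (rule Bochner_Integration.integral_cong) (simp_all add: algebra_simps)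
    also have "\<dots> = ?c - expectation (\<lambda>\<omega>. Z \<omega> * (?S k T \<omega> - ?S k s \<omega>))"
      by (intro Bochner_Integration.integral_diff square_integrable_mult square_integrable_diff Z sqI sqS s T)
    finally have "ennreal (?c\<^sup>2) = ennreal ((expectation (\<lambda>\<omega>. Z \<omega> * ?D \<omega>))\<^sup>2)"
      by (simp add: expectation_mult_simple_increment[OF S s Z])
    also have "\<dots> \<le> ?K * (\<integral>\<^sup>+\<omega>. ennreal ((?D \<omega>)\<^sup>2) \<partial>completion M)"
      by (rule Cauchy_Schwarz_square_integrable[OF Z(2) sqD])
    also have "(\<integral>\<^sup>+\<omega>. ennreal ((?D \<omega>)\<^sup>2) \<partial>completion M) \<le> 2 * ?e k s +
        2 * (\<integral>\<^sup>+\<omega>. ennreal ((I T \<omega> - ?S k T \<omega>)\<^sup>2) \<partial>completion M)"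
      by (intro nn_integral_power2_add_le borel_measurable_diff square_integrable_measurable sqS sqI s T)
    also have "(\<integral>\<^sup>+\<omega>. ennreal ((I T \<omega> - ?S k T \<omega>)\<^sup>2) \<partial>completion M) = ?e k T"
      by (simp add: power2_commute)
    finally show ?thesis by (simp add: mult_left_mono)
  qed
  moreover have "(\<lambda>k. ?K * (2 * ?e k s + 2 * ?e k T)) \<longlonglongrightarrow> ?K * (2 * 0 + 2 * 0)"
  proof (intro ennreal_tendsto_cmult tendsto_add lim s T)
    \<comment> \<open>Finiteness matters: multiplication by an infinite constant is not continuous
      at 0 in \<open>ennreal\<close>.\<close>
    show "?K < top"
      using square_integrable_square[OF Z(2)] by (simp add: nn_integral_eq_integral)
  qed auto
  ultimately have "ennreal (?c\<^sup>2) \<le> ?K * (2 * 0 + 2 * 0)"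
    by (intro LIMSEQ_le_const[of _ _ "ennreal (?c\<^sup>2)"]) auto
  then show ?thesis by simp
qed

lemma ito_L2_bounded:
  assumes \<alpha>: "progressively_measurable F \<alpha>" "energy (completion M) \<alpha> < \<infinity>"
  obtains C where "0 \<le> C" "\<And>s. 0 \<le> s \<Longrightarrow> (\<integral>\<^sup>+\<omega>. ennreal ((I s \<omega>)\<^sup>2) \<partial>completion M) \<le> ennreal C"
proof
  obtain n t \<xi> where S: "\<And>k. simple_data F (n k) (t k) (\<xi> k)"
    and en: "(\<lambda>k. energy (completion M) (\<lambda>s \<omega>. simple_process (n k) (t k) (\<xi> k) s \<omega> - \<alpha> s \<omega>)) \<longlonglongrightarrow> 0"
    and lim: "\<And>s. 0 \<le> s \<Longrightarrow> (\<lambda>k. \<integral>\<^sup>+\<omega>. ennreal ((simple_integral W (n k) (t k) (\<xi> k) s \<omega> - I s \<omega>)\<^sup>2) \<partial>completion M) \<longlonglongrightarrow> 0"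
    by (rule ito_approximation) blast
  let ?S = "\<lambda>k. simple_integral W (n k) (t k) (\<xi> k)"
  let ?E = "energy (completion M) \<alpha>"
  have E: "ennreal (enn2real ?E) = ?E"
    using \<alpha>(2) by simp
  \<comment> \<open>The constant is 2 + 2 (2 + 2E): the squared-sum inequality is used once for
    \<open>I s\<close> around a simple integral and once for the simple process around
    \<open>\<alpha>\<close>, with both errors below 1. The approximant may depend on
    \<open>s\<close>, the constant does not.\<close>
  show "0 \<le> 6 + 4 * enn2real ?E" by simp
  fix s :: real assume s: "0 \<le> s"
  have "eventually (\<lambda>k. (\<integral>\<^sup>+\<omega>. ennreal ((?S k s \<omega> - I s \<omega>)\<^sup>2) \<partial>completion M) < 1 \<and>
      energy (completion M) (\<lambda>s \<omega>. simple_process (n k) (t k) (\<xi> k) s \<omega> - \<alpha> s \<omega>) < 1) sequentially"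
    by (intro eventually_conj order_tendstoD(2)[OF lim[OF s]] order_tendstoD(2)[OF en]) simp_all
  then obtain k where k: "(\<integral>\<^sup>+\<omega>. ennreal ((?S k s \<omega> - I s \<omega>)\<^sup>2) \<partial>completion M) < 1"
      "energy (completion M) (\<lambda>s \<omega>. simple_process (n k) (t k) (\<xi> k) s \<omega> - \<alpha> s \<omega>) < 1"
    by (auto simp: eventually_sequentially)
  have sqS: "square_integrable (completion M) (?S k s)"
    by (rule square_integrable_simple_integral[OF S s])
  have "(\<integral>\<^sup>+\<omega>. ennreal ((I s \<omega>)\<^sup>2) \<partial>completion M) =
      (\<integral>\<^sup>+\<omega>. ennreal (((I s \<omega> - ?S k s \<omega>) + ?S k s \<omega>)\<^sup>2) \<partial>completion M)"
    by simp
  also have "\<dots> \<le> 2 * (\<integral>\<^sup>+\<omega>. ennreal ((I s \<omega> - ?S k s \<omega>)\<^sup>2) \<partial>completion M) +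
      2 * (\<integral>\<^sup>+\<omega>. ennreal ((?S k s \<omega>)\<^sup>2) \<partial>completion M)"
    by (intro nn_integral_power2_add_le borel_measurable_diff ito_measurable s square_integrable_measurable[OF sqS])
  also have "\<dots> \<le> 2 * 1 + 2 * (2 * 1 + 2 * ?E)"
  proof (intro add_mono mult_left_mono)
    show "(\<integral>\<^sup>+\<omega>. ennreal ((I s \<omega> - ?S k s \<omega>)\<^sup>2) \<partial>completion M) \<le> 1"
      using k(1) by (simp add: power2_commute less_imp_le)
    have "(\<integral>\<^sup>+\<omega>. ennreal ((?S k s \<omega>)\<^sup>2) \<partial>completion M) \<le> energy (completion M) (simple_process (n k) (t k) (\<xi> k))"
      by (rule nn_integral_simple_integral_power2_le[OF S s])
    also have "\<dots> \<le> 2 * energy (completion M) (\<lambda>s \<omega>. simple_process (n k) (t k) (\<xi> k) s \<omega> - \<alpha> s \<omega>) + 2 * ?E"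
      by (rule energy_simple_process_le[OF S \<alpha>(1)])
    also have "\<dots> \<le> 2 * 1 + 2 * ?E"
      using k(2) by (intro add_mono mult_left_mono) auto
    finally show "(\<integral>\<^sup>+\<omega>. ennreal ((?S k s \<omega>)\<^sup>2) \<partial>completion M) \<le> 2 * 1 + 2 * ?E" .
  qed simp_all
  also have "\<dots> = 6 + 4 * ?E"
    by (simp add: distrib_left mult.assoc[symmetric] add.assoc[symmetric])
  also have "\<dots> = ennreal (6 + 4 * enn2real ?E)"
    by (subst E[symmetric]) (simp add: ennreal_plus ennreal_mult)
  finally show "(\<integral>\<^sup>+\<omega>. ennreal ((I s \<omega>)\<^sup>2) \<partial>completion M) \<le> ennreal (6 + 4 * enn2real ?E)" .
qed

end

subsection \<open>Hitting times and optional stopping\<close>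

lemma hitting_time_le:
  assumes "0 \<le> t" "y - t + I t \<omega> = 0"
  shows "hitting_time y I \<omega> \<le> ennreal t"
  unfolding hitting_time_def using assms by (intro Inf_lower) blast

text \<open>By continuity the zeros form a closed set, so the infimum is attained. This reduces the
  event to the path up to time \<open>r\<close>.\<close>

lemma hitting_time_le_iff:
  assumes cont: "continuous_on {0..} (\<lambda>t. I t \<omega>)" and r: "0 \<le> r"
  shows "hitting_time y I \<omega> \<le> ennreal r \<longleftrightarrow> (\<exists>s\<in>{0..r}. y - s + I s \<omega> = 0)"
proof
  assume le: "hitting_time y I \<omega> \<le> ennreal r"
  let ?Z = "{0..} \<inter> (\<lambda>t. y - t + I t \<omega>) -` {0}"
  have "continuous_on {0..} (\<lambda>t. y - t + I t \<omega>)"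
    by (intro continuous_intros cont)
  then have closed: "closed ?Z"
    by (rule continuous_closed_preimage) auto
  \<comment> \<open>An empty set has infimum \<open>top\<close> in \<open>ennreal\<close>, which is
    not below \<open>ennreal r\<close>.\<close>
  have ne: "?Z \<noteq> {}"
  proof
    assume "?Z = {}"
    then have "hitting_time y I \<omega> = Inf {}"
      unfolding hitting_time_def by (intro arg_cong[where f=Inf]) auto
    then show False using le by (simp add: top_unique)
  qed
  have bdd: "bdd_below ?Z" by (rule bdd_belowI[of _ 0]) simp
  have Inf: "Inf ?Z \<in> ?Z"
    by (rule closed_contains_Inf[OF ne bdd closed])
  have "ennreal (Inf ?Z) \<le> hitting_time y I \<omega>"
    unfolding hitting_time_def
  proof (rule Inf_greatest)
    fix u assume "u \<in> {ennreal t |t. 0 \<le> t \<and> y - t + I t \<omega> = 0}"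
    then obtain t where "u = ennreal t" "t \<in> ?Z" by auto
    then show "ennreal (Inf ?Z) \<le> u"
      using cInf_lower[OF _ bdd] by (auto intro: ennreal_leI)
  qed
  then have "Inf ?Z \<le> r"
    using le r by (metis ennreal_le_iff order_trans)
  then show "\<exists>s\<in>{0..r}. y - s + I s \<omega> = 0"
    using Inf by (intro bexI[of _ "Inf ?Z"]) auto
next
  assume "\<exists>s\<in>{0..r}. y - s + I s \<omega> = 0"
  then obtain s where "0 \<le> s" "s \<le> r" "y - s + I s \<omega> = 0" by auto
  then show "hitting_time y I \<omega> \<le> ennreal r"
    using hitting_time_le[of s y I \<omega>] ennreal_leI[of s r] by (blast intro: order_trans)
qed

lemma hitting_time_attained:
  assumes cont: "continuous_on {0..} (\<lambda>t. I t \<omega>)" and fin: "hitting_time y I \<omega> < \<infinity>"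
  shows "y - enn2real (hitting_time y I \<omega>) + I (enn2real (hitting_time y I \<omega>)) \<omega> = 0"
proof -
  let ?T = "enn2real (hitting_time y I \<omega>)"
  have T: "hitting_time y I \<omega> = ennreal ?T" using fin by simp
  then obtain s where s: "s \<in> {0..?T}" "y - s + I s \<omega> = 0"
    using hitting_time_le_iff[where y=y and I=I and \<omega>=\<omega>, OF cont, of ?T] by auto
  then have "ennreal ?T \<le> ennreal s"
    using hitting_time_le[of s y I \<omega>] T by simp
  then have "s = ?T" using s(1) by simp
  then show ?thesis using s(2) by simp
qed

text \<open>Intermediate value theorem: the path starts at \<open>y \<ge> 0\<close> and could not
  become nonpositive without a zero.\<close>

lemma hitting_time_infinite_pos:
  assumes cont: "continuous_on {0..} (\<lambda>t. I t \<omega>)" and inf: "hitting_time y I \<omega> = \<infinity>"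
    and "0 \<le> y" "I 0 \<omega> = 0" and t: "0 \<le> t"
  shows "0 < y - t + I t \<omega>"
proof (rule ccontr)
  assume "\<not> 0 < y - t + I t \<omega>"
  moreover have "continuous_on {0..t} (\<lambda>t. y - t + I t \<omega>)"
    by (intro continuous_intros continuous_on_subset[OF cont]) auto
  ultimately obtain s where "0 \<le> s" "y - s + I s \<omega> = 0"
    using IVT2'[of "\<lambda>t. y - t + I t \<omega>" t 0 0] assms by auto
  then show False
    using hitting_time_le[of s y I \<omega>] inf by (simp add: top_unique)
qed

context ito_process
begin

text \<open>The event is an uncountable union over times up to \<open>r\<close>. Continuity on a
  compact interval replaces it by a countable condition: the path comes arbitrarily close to 0 on a
  countable dense set of times.\<close>

lemma stopping_time_hitting_time: "stopping_time F (hitting_time y I)"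
proof (rule stopping_timeI)
  fix t :: ennreal
  show "Measurable.pred (F t) (\<lambda>\<omega>. hitting_time y I \<omega> \<le> t)"
  proof (cases t)
    case (real r)
    \<comment> \<open>\<open>D\<close> lies inside the interval, so only values of \<open>I\<close>
      known at time \<open>r\<close> enter.\<close>
    obtain D where D: "countable D" "D \<subseteq> {0..r}" "{0..r} \<subseteq> closure D"
      using separable[of "{0..r}"] by blast
    have "hitting_time y I \<omega> \<le> t \<longleftrightarrow> (\<forall>m. \<exists>q\<in>D. \<bar>y - q + I q \<omega>\<bar> < inverse (Suc m))"
      if \<omega>: "\<omega> \<in> space M" for \<omega>
    proof -
      let ?p = "\<lambda>s. \<bar>y - s + I s \<omega>\<bar>"
      have cont: "continuous_on {0..r} ?p"
        by (intro continuous_intros continuous_on_subset[OF ito_continuous[OF \<omega>]]) auto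
      have "(\<exists>s\<in>{0..r}. y - s + I s \<omega> = 0) \<longleftrightarrow> (\<forall>m. \<exists>q\<in>D. ?p q < inverse (Suc m))"
      proof
        assume "\<exists>s\<in>{0..r}. y - s + I s \<omega> = 0"
        then obtain s where s: "s \<in> {0..r}" "?p s = 0" by auto
        show "\<forall>m. \<exists>q\<in>D. ?p q < inverse (Suc m)"
        proof
          fix m
          obtain d where d: "d > 0" "\<And>q. q \<in> {0..r} \<Longrightarrow> dist q s < d \<Longrightarrow> dist (?p q) (?p s) < inverse (Suc m)"
            using cont s(1) unfolding continuous_on_iff by (metis inverse_positive_iff_positive of_nat_0_less_iff zero_less_Suc)
          moreover obtain q where "q \<in> D" "dist q s < d"
            using D(3) s(1) d(1) unfolding closure_approachable subset_iff by blast
          ultimately show "\<exists>q\<in>D. ?p q < inverse (Suc m)"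
            using D(2) s(2) by (intro bexI[of _ q]) (auto simp: dist_real_def subset_iff)
        qed
      next
        assume small: "\<forall>m. \<exists>q\<in>D. ?p q < inverse (Suc m)"
        \<comment> \<open>The minimum of the absolute value is attained, and small values on
          \<open>D\<close> force it to be 0.\<close>
        obtain s where s: "s \<in> {0..r}" "\<And>q. q \<in> {0..r} \<Longrightarrow> ?p s \<le> ?p q"
          using continuous_attains_inf[OF _ _ cont] real by auto
        have "\<not> 0 < ?p s"
        proof
          assume "0 < ?p s"
          then obtain m where "inverse (real (Suc m)) < ?p s"
            using reals_Archimedean by blast
          moreover obtain q where "q \<in> D" "?p q < inverse (Suc m)"
            using small by blast
          ultimately show False
            using s(2)[of q] D(2) by force
        qed
        then show "\<exists>s\<in>{0..r}. y - s + I s \<omega> = 0"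
          using s(1) by (intro bexI[of _ s]) auto
      qed
      then show ?thesis
        using hitting_time_le_iff[where y=y and I=I and \<omega>=\<omega> and r=r, OF ito_continuous[OF \<omega>]] real by simp
    qed
    moreover have "Measurable.pred (F t) (\<lambda>\<omega>. \<forall>m. \<exists>q\<in>D. \<bar>y - q + I q \<omega>\<bar> < inverse (Suc m))"
      unfolding pred_def
    proof (intro sets.sets_Collect_countable_All sets.sets_Collect_countable_Ex' D(1))
      fix m q assume "q \<in> D"
      then have "I q \<in> borel_measurable (F t)"
        using D(2) real by (intro measurable_F_mono[OF ito_adapted]) (auto intro: ennreal_leI)
      then show "{\<omega> \<in> space (F t). \<bar>y - q + I q \<omega>\<bar> < inverse (Suc m)} \<in> sets (F t)"
        by measurable
    qed
    ultimately show ?thesis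
      by (subst measurable_cong) (auto simp: space_F)
  qed simp
qed

text \<open>Optional stopping for a time with values on a finite grid. The event of stopping at
  index \<open>j\<close> is known at that time, so its indicator is an admissible test function and
  \<open>I\<close> at index \<open>j\<close> may be exchanged there for \<open>I\<close> at the last
  index \<open>N\<close>. For squares the test function is the indicator times
  \<open>X j\<close>.\<close>

lemma ito_discrete_stopping:
  fixes J :: "'a \<Rightarrow> nat"
  assumes h: "0 \<le> h" and J: "\<And>\<omega>. \<omega> \<in> space M \<Longrightarrow> J \<omega> \<le> N"
    and A: "\<And>j. j \<le> N \<Longrightarrow> {\<omega> \<in> space M. J \<omega> = j} \<in> sets (F (ennreal (real j * h)))"
  shows "square_integrable (completion M) (\<lambda>\<omega>. I (real (J \<omega>) * h) \<omega>)"
    and "expectation (\<lambda>\<omega>. I (real (J \<omega>) * h) \<omega>) = 0"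
    and "(\<integral>\<^sup>+\<omega>. ennreal ((I (real (J \<omega>) * h) \<omega>)\<^sup>2) \<partial>completion M)
           \<le> (\<integral>\<^sup>+\<omega>. ennreal ((I (real N * h) \<omega>)\<^sup>2) \<partial>completion M)"
proof -
  define B where "B j = {\<omega> \<in> space M. J \<omega> = j}" for j
  define X where "X j = I (real j * h)" for j :: nat
  have decomp: "c (J \<omega>) = (\<Sum>j\<le>N. indicator (B j) \<omega> * c j)" if \<omega>: "\<omega> \<in> space M" for c :: "nat \<Rightarrow> real" and \<omega>
  proof -
    have "(\<Sum>j\<le>N. indicator (B j) \<omega> * c j) = (\<Sum>j\<le>N. if j = J \<omega> then c j else 0)"
      using \<omega> by (intro sum.cong) (auto simp: B_def)
    then show ?thesis using J[OF \<omega>] by simp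
  qed
  have Bj: "B j \<in> sets (F (ennreal (real j * h)))" "B j \<in> sets (completion M)" if "j \<le> N" for j
    using A[OF that] sets_F_subset unfolding B_def by auto
  have sqX: "square_integrable (completion M) (X j)" for j
    unfolding X_def using h by (intro ito_square_integrable) simp
  have sqBX: "square_integrable (completion M) (\<lambda>\<omega>. indicator (B j) \<omega> * X i \<omega>)" if "j \<le> N" for i j
    by (rule square_integrable_indicator_mult[OF Bj(2)[OF that] sqX])
  have sqY': "square_integrable (completion M) (\<lambda>\<omega>. \<Sum>j\<le>N. indicator (B j) \<omega> * X j \<omega>)"
    by (intro square_integrable_sum sqBX) simp
  have Y_eq: "I (real (J \<omega>) * h) \<omega> = (\<Sum>j\<le>N. indicator (B j) \<omega> * X j \<omega>)" if "\<omega> \<in> space M" for \<omega>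
    using decomp[OF that, of "\<lambda>j. X j \<omega>"] by (simp add: X_def)
  show sqY: "square_integrable (completion M) (\<lambda>\<omega>. I (real (J \<omega>) * h) \<omega>)"
    using sqY' Y_eq by (subst square_integrable_cong) auto
  \<comment> \<open>After the exchange on every piece, this reassembles the pieces to
    \<open>X N\<close>.\<close>
  have X_N: "X N \<omega> = (\<Sum>j\<le>N. indicator (B j) \<omega> * X N \<omega>)" if "\<omega> \<in> space M" for \<omega>
    using decomp[OF that, of "\<lambda>_. X N \<omega>"] .
  have iBX: "integrable (completion M) (\<lambda>\<omega>. indicator (B j) \<omega> * X i \<omega>)" if "j \<le> N" for i j
    by (rule square_integrable_integrable[OF sqBX[OF that]])
  have X_mart: "expectation (\<lambda>\<omega>. Z \<omega> * (X N \<omega> - X j \<omega>)) = 0"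
    if "j \<le> N" "Z \<in> borel_measurable (F (ennreal (real j * h)))" "square_integrable (completion M) Z" for Z j
    unfolding X_def using that h by (intro ito_martingale) (auto intro: mult_right_mono)
  have X_N_0: "expectation (X N) = 0"
  proof -
    have "expectation (\<lambda>\<omega>. X N \<omega> - X 0 \<omega>) = 0"
      using X_mart[of 0 "\<lambda>_. 1"] by (simp add: square_integrable_def)
    moreover have "expectation (X 0) = 0"
      using ito_zero by (intro integral_eq_zero_AE) (simp add: X_def)
    ultimately show ?thesis
      by (simp add: square_integrable_integrable[OF sqX])
  qed
  have Bj_mart: "expectation (\<lambda>\<omega>. indicator (B j) \<omega> * X j \<omega>) = expectation (\<lambda>\<omega>. indicator (B j) \<omega> * X N \<omega>)"
    if j: "j \<le> N" for j
  proof -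
    have "expectation (\<lambda>\<omega>. indicator (B j) \<omega> * (X N \<omega> - X j \<omega>)) = 0"
      using Bj(1)[OF j] square_integrable_indicator_mult[OF Bj(2)[OF j], of "\<lambda>_. 1"]
      by (intro X_mart j borel_measurable_indicator) (auto simp: square_integrable_def[of _ "\<lambda>_. 1"])
    then show ?thesis
      using iBX[OF j] by (simp add: right_diff_distrib)
  qed
  have "expectation (\<lambda>\<omega>. I (real (J \<omega>) * h) \<omega>) = expectation (\<lambda>\<omega>. \<Sum>j\<le>N. indicator (B j) \<omega> * X j \<omega>)"
    using Y_eq by (intro Bochner_Integration.integral_cong) auto
  also have "\<dots> = (\<Sum>j\<le>N. expectation (\<lambda>\<omega>. indicator (B j) \<omega> * X N \<omega>))"
    using iBX by (subst Bochner_Integration.integral_sum) (auto intro!: sum.cong Bj_mart)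
  also have "\<dots> = expectation (\<lambda>\<omega>. \<Sum>j\<le>N. indicator (B j) \<omega> * X N \<omega>)"
    using iBX by (subst Bochner_Integration.integral_sum) auto
  also have "\<dots> = expectation (X N)"
    using X_N by (intro Bochner_Integration.integral_cong) auto
  finally show "expectation (\<lambda>\<omega>. I (real (J \<omega>) * h) \<omega>) = 0"
    using X_N_0 by simp
  have iBX2: "integrable (completion M) (\<lambda>\<omega>. indicator (B j) \<omega> * (X i \<omega>)\<^sup>2)" if j: "j \<le> N" for i j
    using integrable_mult_indicator[OF Bj(2)[OF j] square_integrable_square[OF sqX[of i]]] by simp
  have Bj_le: "expectation (\<lambda>\<omega>. indicator (B j) \<omega> * (X j \<omega>)\<^sup>2) \<le> expectation (\<lambda>\<omega>. indicator (B j) \<omega> * (X N \<omega>)\<^sup>2)"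
    if j: "j \<le> N" for j
  proof -
    let ?Z = "\<lambda>\<omega>. indicator (B j) \<omega> * X j \<omega>"
    have "X j \<in> borel_measurable (F (ennreal (real j * h)))"
      unfolding X_def using h by (intro ito_adapted) simp
    then have "?Z \<in> borel_measurable (F (ennreal (real j * h)))"
      using Bj(1)[OF j] by (intro borel_measurable_times borel_measurable_indicator)
    then have 0: "expectation (\<lambda>\<omega>. ?Z \<omega> * (X N \<omega> - X j \<omega>)) = 0"
      by (intro X_mart j sqBX)
    have i0: "integrable (completion M) (\<lambda>\<omega>. ?Z \<omega> * (X N \<omega> - X j \<omega>))"
      by (intro square_integrable_mult sqBX j square_integrable_diff sqX)
    \<comment> \<open>Adding a term of mean 0 completes the square: what is then missing to
      \<open>X N\<close> squared is the square of \<open>X N - X j\<close> on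
      \<open>B j\<close>.\<close>
    have "expectation (\<lambda>\<omega>. indicator (B j) \<omega> * (X j \<omega>)\<^sup>2) =
        expectation (\<lambda>\<omega>. indicator (B j) \<omega> * (X j \<omega>)\<^sup>2 + 2 * (?Z \<omega> * (X N \<omega> - X j \<omega>)))"
      using iBX2[OF j] i0 0 by simp
    also have "\<dots> \<le> expectation (\<lambda>\<omega>. indicator (B j) \<omega> * (X N \<omega>)\<^sup>2)"
    proof (rule integral_mono)
      fix \<omega>
      have "0 \<le> indicator (B j) \<omega> * (X N \<omega> - X j \<omega>)\<^sup>2" by simp
      then show "indicator (B j) \<omega> * (X j \<omega>)\<^sup>2 + 2 * (?Z \<omega> * (X N \<omega> - X j \<omega>)) \<le> indicator (B j) \<omega> * (X N \<omega>)\<^sup>2"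
        by (simp add: power2_eq_square algebra_simps)
    qed (use iBX2[OF j] i0 in auto)
    finally show ?thesis .
  qed
  have "expectation (\<lambda>\<omega>. (I (real (J \<omega>) * h) \<omega>)\<^sup>2) = expectation (\<lambda>\<omega>. \<Sum>j\<le>N. indicator (B j) \<omega> * (X j \<omega>)\<^sup>2)"
  proof (intro Bochner_Integration.integral_cong refl)
    fix \<omega> assume "\<omega> \<in> space (completion M)"
    then show "(I (real (J \<omega>) * h) \<omega>)\<^sup>2 = (\<Sum>j\<le>N. indicator (B j) \<omega> * (X j \<omega>)\<^sup>2)"
      using decomp[of \<omega> "\<lambda>j. (X j \<omega>)\<^sup>2"] by (simp add: X_def)
  qed
  also have "\<dots> = (\<Sum>j\<le>N. expectation (\<lambda>\<omega>. indicator (B j) \<omega> * (X j \<omega>)\<^sup>2))"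
    using iBX2 by (intro Bochner_Integration.integral_sum) auto
  also have "\<dots> \<le> (\<Sum>j\<le>N. expectation (\<lambda>\<omega>. indicator (B j) \<omega> * (X N \<omega>)\<^sup>2))"
    by (intro sum_mono Bj_le) simp
  also have "\<dots> = expectation (\<lambda>\<omega>. \<Sum>j\<le>N. indicator (B j) \<omega> * (X N \<omega>)\<^sup>2)"
    using iBX2 by (intro Bochner_Integration.integral_sum[symmetric]) auto
  also have "\<dots> = expectation (\<lambda>\<omega>. (X N \<omega>)\<^sup>2)"
    using decomp[of _ "\<lambda>_. (X N _)\<^sup>2"] by (intro Bochner_Integration.integral_cong refl) (metis space_completion)
  finally show "(\<integral>\<^sup>+\<omega>. ennreal ((I (real (J \<omega>) * h) \<omega>)\<^sup>2) \<partial>completion M)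
           \<le> (\<integral>\<^sup>+\<omega>. ennreal ((I (real N * h) \<omega>)\<^sup>2) \<partial>completion M)"
    using square_integrable_square[OF sqY] square_integrable_square[OF sqX[of N]]
    by (simp add: nn_integral_eq_integral X_def ennreal_leI)
qed

end

section \<open>Grid approximation and the first two moments of the hitting time\<close>

context ito_process
begin

context
  fixes y :: real
begin

abbreviation "\<tau> \<equiv> hitting_time y I"

text \<open>Upper discretisation of \<open>\<tau>\<close> on the grid of mesh \<open>1 / (k + 1)\<close>, capped at \<open>k + 1\<close>.\<close>

definition grid_index :: "nat \<Rightarrow> 'a \<Rightarrow> nat" where
  "grid_index k \<omega> = (LEAST j. j = (Suc k)\<^sup>2 \<or> \<tau> \<omega> \<le> ennreal (real j * inverse (real (Suc k))))"

definition grid_value :: "nat \<Rightarrow> 'a \<Rightarrow> real" where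
  "grid_value k \<omega> = I (real (grid_index k \<omega>) * inverse (real (Suc k))) \<omega>"

text \<open>The cap \<open>(Suc k)\<^sup>2\<close> is chosen for this: as \<open>k\<close> grows,
  the mesh tends to 0 and the horizon to infinity at once.\<close>

lemma grid_end: "real ((Suc k)\<^sup>2) * inverse (real (Suc k)) = real (Suc k)"
  unfolding power2_eq_square of_nat_mult mult.assoc by simp

lemma grid_index_le: "grid_index k \<omega> \<le> (Suc k)\<^sup>2"
  unfolding grid_index_def by (rule Least_le) simp

text \<open>The cap is a disjunct of the defining condition, so the least index exists even where
  \<open>\<tau>\<close> is infinite.\<close>

lemma grid_index_reached:
  "grid_index k \<omega> = (Suc k)\<^sup>2 \<or> \<tau> \<omega> \<le> ennreal (real (grid_index k \<omega>) * inverse (real (Suc k)))"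
  unfolding grid_index_def by (rule LeastI[of _ "(Suc k)\<^sup>2"]) simp

lemma grid_index_minimal:
  "i < grid_index k \<omega> \<Longrightarrow> \<not> \<tau> \<omega> \<le> ennreal (real i * inverse (real (Suc k)))"
  unfolding grid_index_def using not_less_Least by blast

text \<open>Turns the least index into a finite Boolean combination of events
  \<open>\<tau> \<le> i / (k + 1)\<close> with \<open>i \<le> j\<close>, all of them known at the
  grid time with index \<open>j\<close>.\<close>

lemma grid_index_eq_iff:
  assumes "j \<le> (Suc k)\<^sup>2"
  shows "grid_index k \<omega> = j \<longleftrightarrow>
    (j = (Suc k)\<^sup>2 \<or> \<tau> \<omega> \<le> ennreal (real j * inverse (real (Suc k)))) \<and>
    (\<forall>i<j. \<not> \<tau> \<omega> \<le> ennreal (real i * inverse (real (Suc k))))"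
proof
  assume *: "(j = (Suc k)\<^sup>2 \<or> \<tau> \<omega> \<le> ennreal (real j * inverse (real (Suc k)))) \<and>
    (\<forall>i<j. \<not> \<tau> \<omega> \<le> ennreal (real i * inverse (real (Suc k))))"
  then have "grid_index k \<omega> \<le> j"
    unfolding grid_index_def by (intro Least_le) simp
  moreover have "\<not> grid_index k \<omega> < j"
    using grid_index_reached[of k \<omega>] * assms by auto
  ultimately show "grid_index k \<omega> = j" by simp
qed (use grid_index_reached[of k \<omega>] grid_index_minimal[of _ k \<omega>] in blast)

lemma grid_index_sets:
  assumes "j \<le> (Suc k)\<^sup>2"
  shows "{\<omega> \<in> space M. grid_index k \<omega> = j} \<in> sets (F (ennreal (real j * inverse (real (Suc k)))))"
proof -
  let ?F = "F (ennreal (real j * inverse (real (Suc k))))"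
  have P: "{\<omega> \<in> space ?F. \<tau> \<omega> \<le> ennreal (real i * inverse (real (Suc k)))} \<in> sets ?F" if "i \<le> j" for i
    unfolding pred_def[symmetric]
  proof (rule measurable_F_mono[OF stopping_timeD[OF stopping_time_hitting_time]])
    show "ennreal (real i * inverse (real (Suc k))) \<le> ennreal (real j * inverse (real (Suc k)))"
      using that by (intro ennreal_leI mult_right_mono) auto
  qed
  have "{\<omega> \<in> space ?F. (j = (Suc k)\<^sup>2 \<or> \<tau> \<omega> \<le> ennreal (real j * inverse (real (Suc k)))) \<and>
      (\<forall>i\<in>{..<j}. \<not> \<tau> \<omega> \<le> ennreal (real i * inverse (real (Suc k))))} \<in> sets ?F"
    by (intro sets.sets_Collect_conj sets.sets_Collect_disj sets.sets_Collect_const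
      sets.sets_Collect_finite_All sets.sets_Collect_neg P) simp_all
  then show ?thesis
    unfolding grid_index_eq_iff[OF assms] space_F Ball_def lessThan_iff .
qed

lemmas grid_value_facts = ito_discrete_stopping
  [of "inverse (real (Suc k))" "grid_index k" "(Suc k)\<^sup>2" for k, folded grid_value_def,
    OF _ grid_index_le grid_index_sets]

lemma grid_value_square_integrable: "square_integrable (completion M) (grid_value k)"
  and expectation_grid_value: "expectation (grid_value k) = 0"
  and grid_value_L2_le: "(\<integral>\<^sup>+\<omega>. ennreal ((grid_value k \<omega>)\<^sup>2) \<partial>completion M)
           \<le> (\<integral>\<^sup>+\<omega>. ennreal ((I (real (Suc k)) \<omega>)\<^sup>2) \<partial>completion M)"
proof -
  show "square_integrable (completion M) (grid_value k)" "expectation (grid_value k) = 0"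
    using grid_value_facts(1,2)[of k] by simp_all
  show "(\<integral>\<^sup>+\<omega>. ennreal ((grid_value k \<omega>)\<^sup>2) \<partial>completion M)
           \<le> (\<integral>\<^sup>+\<omega>. ennreal ((I (real (Suc k)) \<omega>)\<^sup>2) \<partial>completion M)"
    using grid_value_facts(3)[of k] unfolding grid_end by simp
qed

lemma grid_value_tendsto:
  assumes \<omega>: "\<omega> \<in> space M" and fin: "\<tau> \<omega> < \<infinity>"
  shows "(\<lambda>k. grid_value k \<omega>) \<longlonglongrightarrow> enn2real (\<tau> \<omega>) - y"
proof -
  let ?s = "\<lambda>k. real (grid_index k \<omega>) * inverse (real (Suc k))"
  obtain T where T: "\<tau> \<omega> = ennreal T" "0 \<le> T"
    using fin by (cases "\<tau> \<omega>") auto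
  obtain k0 where k0: "T \<le> real k0" using real_arch_simple by blast
  \<comment> \<open>Once the horizon \<open>k + 1\<close> exceeds \<open>T\<close>, the grid time is
    at least \<open>T\<close> whether it is the cap or not.\<close>
  have lower: "T \<le> ?s k" if "k \<ge> k0" for k
  proof -
    have "T \<le> real (Suc k)" using k0 that by simp
    also have "real (Suc k) = real ((Suc k)\<^sup>2) * inverse (real (Suc k))"
      by (rule grid_end[symmetric])
    finally have "\<tau> \<omega> \<le> ennreal (real ((Suc k)\<^sup>2) * inverse (real (Suc k)))"
      unfolding T(1) by (rule ennreal_leI)
    then have "ennreal T \<le> ennreal (?s k)"
      using grid_index_reached[of k \<omega>] unfolding T(1) by metis
    then show ?thesis by (subst (asm) ennreal_le_iff) auto
  qed
  \<comment> \<open>By minimality the preceding grid point has not reached \<open>T\<close>; index 0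
    has no predecessor but gives time 0.\<close>
  have upper: "?s k \<le> T + inverse (real (Suc k))" for k
  proof (cases "grid_index k \<omega>")
    case (Suc i)
    then have "\<not> ennreal T \<le> ennreal (real i * inverse (real (Suc k)))"
      using grid_index_minimal[of i k \<omega>] T(1) Suc by simp
    then have "real i * inverse (real (Suc k)) \<le> T"
      by (meson ennreal_leI linear)
    then show ?thesis by (simp add: Suc algebra_simps)
  qed (use T(2) in simp)
  have "?s \<longlonglongrightarrow> T"
  proof (rule tendsto_sandwich)
    show "eventually (\<lambda>k. T \<le> ?s k) sequentially"
      using eventually_ge_at_top[of k0] by eventually_elim (rule lower)
    show "eventually (\<lambda>k. ?s k \<le> T + inverse (real (Suc k))) sequentially"
      using upper by simp
    show "(\<lambda>k. T + inverse (real (Suc k))) \<longlonglongrightarrow> T"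
      using tendsto_add[OF tendsto_const LIMSEQ_inverse_real_of_nat, of T] by simp
  qed simp
  then have "(\<lambda>k. grid_value k \<omega>) \<longlonglongrightarrow> I T \<omega>"
    unfolding grid_value_def
    by (rule continuous_on_tendsto_compose[OF ito_continuous[OF \<omega>]]) (use T(2) in auto)
  moreover have "I T \<omega> = T - y"
    using hitting_time_attained[where y=y and I=I and \<omega>=\<omega>, OF ito_continuous[OF \<omega>] fin] T by simp
  ultimately show ?thesis using T by simp
qed

text \<open>Without a zero the grid time is the cap \<open>k + 1\<close>, where the path of
  \<open>y - t + I_t\<close> is still positive.\<close>

lemma grid_value_infinite:
  assumes \<omega>: "\<omega> \<in> space M" and inf: "\<tau> \<omega> = \<infinity>" and "0 \<le> y" "I 0 \<omega> = 0"
  shows "real (Suc k) - y \<le> grid_value k \<omega>"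
proof -
  have "grid_index k \<omega> = (Suc k)\<^sup>2"
    using grid_index_reached[of k \<omega>] unfolding inf by (simp add: top_unique)
  then have "grid_value k \<omega> = I (real (Suc k)) \<omega>"
    unfolding grid_value_def by (simp only: grid_end)
  then show ?thesis
    using hitting_time_infinite_pos[where y=y and I=I and \<omega>=\<omega>, OF ito_continuous[OF \<omega>] inf assms(3,4), of "real (Suc k)"] by simp
qed

text \<open>On \<open>\<tau> = \<infinity>\<close> the right-hand side is infinite, so that Fatou's lemma yields finiteness of \<open>\<tau>\<close> and
  its second moment at once.\<close>

lemma hitting_time_power2_le_liminf:
  assumes \<omega>: "\<omega> \<in> space M" and "0 \<le> y" "I 0 \<omega> = 0"
  shows "(\<tau> \<omega>)\<^sup>2 \<le> 2 * ennreal (y\<^sup>2) + 2 * liminf (\<lambda>k. ennreal ((grid_value k \<omega>)\<^sup>2))"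
proof (cases "\<tau> \<omega> < \<infinity>")
  case True
  let ?T = "enn2real (\<tau> \<omega>)"
  have "(\<lambda>k. ennreal ((grid_value k \<omega>)\<^sup>2)) \<longlonglongrightarrow> ennreal ((?T - y)\<^sup>2)"
    by (intro tendsto_ennrealI tendsto_power grid_value_tendsto \<omega> True)
  then have "liminf (\<lambda>k. ennreal ((grid_value k \<omega>)\<^sup>2)) = ennreal ((?T - y)\<^sup>2)"
    by (intro lim_imp_Liminf) auto
  moreover have "(\<tau> \<omega>)\<^sup>2 = ennreal ((y + (?T - y))\<^sup>2)"
    using True by (simp flip: ennreal_power)
  ultimately show ?thesis
    using ennreal_power2_add_le[of y "?T - y"] by simp
next
  case False
  then have inf: "\<tau> \<omega> = \<infinity>" by (simp add: not_less top_unique)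
  let ?L = "liminf (\<lambda>k. ennreal ((grid_value k \<omega>)\<^sup>2))"
  have big: "ennreal B \<le> ?L" for B
  proof (rule Liminf_bounded)
    \<comment> \<open>The 1 ensures that the grid value is at most its own square, so a lower bound
      on the value carries over.\<close>
    obtain k0 where k0: "y + max 1 B \<le> real k0" using real_arch_simple by blast
    show "eventually (\<lambda>k. ennreal B \<le> ennreal ((grid_value k \<omega>)\<^sup>2)) sequentially"
      using eventually_ge_at_top[of k0]
    proof eventually_elim
      case (elim k)
      then have "max 1 B \<le> grid_value k \<omega>"
        using k0 grid_value_infinite[OF \<omega> inf assms(2,3), of k] by linarith
      then have "B \<le> grid_value k \<omega> * 1" "1 \<le> grid_value k \<omega>" by auto
      moreover from this(2) have "grid_value k \<omega> * 1 \<le> grid_value k \<omega> * grid_value k \<omega>"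
        by (intro mult_left_mono) auto
      ultimately show ?case
        unfolding power2_eq_square by (intro ennreal_leI) linarith
    qed
  qed
  have "?L = top"
  proof (rule ccontr)
    assume "?L \<noteq> top"
    then obtain l where l: "0 \<le> l" "?L = ennreal l" by (cases ?L) auto
    then show False using big[of "l + 1"] by simp
  qed
  then show ?thesis by simp
qed

text \<open>The order matters: the second moment comes first and gives almost sure finiteness, which
  is what identifies the limit of the grid values as \<open>\<tau> - y\<close>. The uniform
  \<open>L^2\<close> bound then carries their mean 0 over to this limit.\<close>

lemma hitting_time_moments:
  assumes y: "0 \<le> y" and \<alpha>: "progressively_measurable F \<alpha>" "energy (completion M) \<alpha> < \<infinity>"
  shows "(\<integral>\<^sup>+\<omega>. (\<tau> \<omega>)\<^sup>2 \<partial>completion M) < \<infinity>"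
    and "(\<integral>\<^sup>+\<omega>. \<tau> \<omega> \<partial>completion M) = ennreal y"
proof -
  obtain C where C: "0 \<le> C" "\<And>s. 0 \<le> s \<Longrightarrow> (\<integral>\<^sup>+\<omega>. ennreal ((I s \<omega>)\<^sup>2) \<partial>completion M) \<le> ennreal C"
    using ito_L2_bounded[OF \<alpha>] by blast
  have grid_C: "(\<integral>\<^sup>+\<omega>. ennreal ((grid_value k \<omega>)\<^sup>2) \<partial>completion M) \<le> ennreal C" for k
    using grid_value_L2_le[of k] C(2)[of "real (Suc k)"] by (rule order_trans) simp
  have [measurable]: "grid_value k \<in> borel_measurable (completion M)" for k
    using grid_value_square_integrable by (rule square_integrable_measurable)
  have \<tau>_meas [measurable]: "\<tau> \<in> borel_measurable (completion M)"
    by (rule measurable_stopping_time[OF stopping_time_hitting_time sets_F_subset]) (simp add: space_F)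
  have "(\<integral>\<^sup>+\<omega>. (\<tau> \<omega>)\<^sup>2 \<partial>completion M) \<le>
      (\<integral>\<^sup>+\<omega>. 2 * ennreal (y\<^sup>2) + 2 * liminf (\<lambda>k. ennreal ((grid_value k \<omega>)\<^sup>2)) \<partial>completion M)"
  proof (rule nn_integral_mono_AE)
    show "AE \<omega> in completion M. (\<tau> \<omega>)\<^sup>2 \<le> 2 * ennreal (y\<^sup>2) + 2 * liminf (\<lambda>k. ennreal ((grid_value k \<omega>)\<^sup>2))"
      using ito_zero AE_space
    proof eventually_elim
      case (elim \<omega>)
      then show ?case using y by (intro hitting_time_power2_le_liminf) auto
    qed
  qed
  also have "\<dots> = 2 * ennreal (y\<^sup>2) + 2 * (\<integral>\<^sup>+\<omega>. liminf (\<lambda>k. ennreal ((grid_value k \<omega>)\<^sup>2)) \<partial>completion M)"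
    by (subst nn_integral_add) (simp_all add: nn_integral_cmult emeasure_space_1[simplified])
  also have "\<dots> \<le> 2 * ennreal (y\<^sup>2) + 2 * ennreal C"
  proof (intro add_mono mult_left_mono order_refl)
    have "(\<integral>\<^sup>+\<omega>. liminf (\<lambda>k. ennreal ((grid_value k \<omega>)\<^sup>2)) \<partial>completion M) \<le>
        liminf (\<lambda>k. \<integral>\<^sup>+\<omega>. ennreal ((grid_value k \<omega>)\<^sup>2) \<partial>completion M)"
      by (rule nn_integral_liminf) measurable
    also have "\<dots> \<le> ennreal C"
      using grid_C by (intro Liminf_le) auto
    finally show "(\<integral>\<^sup>+\<omega>. liminf (\<lambda>k. ennreal ((grid_value k \<omega>)\<^sup>2)) \<partial>completion M) \<le> ennreal C" .
  qed simp_all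
  also have "\<dots> = ennreal (2 * y\<^sup>2 + 2 * C)"
    using C(1) by (simp add: ennreal_plus ennreal_mult)
  finally have \<tau>2: "(\<integral>\<^sup>+\<omega>. (\<tau> \<omega>)\<^sup>2 \<partial>completion M) \<le> ennreal (2 * y\<^sup>2 + 2 * C)" .
  then show "(\<integral>\<^sup>+\<omega>. (\<tau> \<omega>)\<^sup>2 \<partial>completion M) < \<infinity>"
    by (rule le_less_trans) simp
  then have "AE \<omega> in completion M. (\<tau> \<omega>)\<^sup>2 \<noteq> \<infinity>"
    by (intro nn_integral_PInf_AE) auto
  then have fin: "AE \<omega> in completion M. \<tau> \<omega> < \<infinity>"
  proof eventually_elim
    case (elim \<omega>)
    then show ?case by (cases "\<tau> \<omega>") auto
  qed
  \<comment> \<open>A real-valued version for Bochner integrals; the default 0 of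
    \<open>enn2real\<close> is taken only on the null set where \<open>\<tau>\<close> is
    infinite.\<close>
  define T where "T \<omega> = enn2real (\<tau> \<omega>)" for \<omega>
  have [measurable]: "T \<in> borel_measurable (completion M)"
    unfolding T_def by measurable
  have "(\<integral>\<^sup>+\<omega>. ennreal ((T \<omega>)\<^sup>2) \<partial>completion M) \<le> (\<integral>\<^sup>+\<omega>. (\<tau> \<omega>)\<^sup>2 \<partial>completion M)"
  proof (rule nn_integral_mono_AE)
    show "AE \<omega> in completion M. ennreal ((T \<omega>)\<^sup>2) \<le> (\<tau> \<omega>)\<^sup>2"
      using fin by eventually_elim (simp add: T_def flip: ennreal_power)
  qed
  with \<tau>2 have T2: "(\<integral>\<^sup>+\<omega>. ennreal ((T \<omega>)\<^sup>2) \<partial>completion M) \<le> ennreal (2 * y\<^sup>2 + 2 * C)"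
    by simp
  have sqT: "square_integrable (completion M) T"
    using le_less_trans[OF T2] by (intro square_integrable_nn) auto
  have intT: "integrable (completion M) T"
    by (rule square_integrable_integrable[OF sqT])
  \<comment> \<open>The common bound \<open>6 * y\<^sup>2 + 4 * C\<close> is 2 (2y^2 + 2C) + 2y^2,
    the bound for the limit \<open>T - y\<close>; it also exceeds the bound \<open>C\<close> for the
    grid values.\<close>
  have "(\<lambda>k. expectation (grid_value k)) \<longlonglongrightarrow> expectation (\<lambda>\<omega>. T \<omega> - y)"
  proof (rule expectation_tendsto_of_L2_bounded[where C="6 * y\<^sup>2 + 4 * C"])
    show "(\<integral>\<^sup>+\<omega>. ennreal ((grid_value k \<omega>)\<^sup>2) \<partial>completion M) \<le> ennreal (6 * y\<^sup>2 + 4 * C)" for k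
      using grid_C[of k] C(1) by (rule_tac order_trans) (auto intro!: ennreal_leI add_increasing)
    have two: "2 * ennreal r = ennreal (2 * r)" if "0 \<le> r" for r
      using that by (simp add: ennreal_mult)
    have "(\<integral>\<^sup>+\<omega>. ennreal ((T \<omega> - y)\<^sup>2) \<partial>completion M) \<le>
        2 * (\<integral>\<^sup>+\<omega>. ennreal ((T \<omega>)\<^sup>2) \<partial>completion M) + 2 * (\<integral>\<^sup>+\<omega>. ennreal ((- y)\<^sup>2) \<partial>completion M)"
      using nn_integral_power2_add_le[of T "completion M" "\<lambda>_. - y"] by simp
    also have "\<dots> \<le> 2 * ennreal (2 * y\<^sup>2 + 2 * C) + 2 * ennreal (y\<^sup>2)"
      using T2 by (intro add_mono mult_left_mono) (simp_all add: emeasure_space_1[simplified])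
    also have "\<dots> = ennreal (2 * (2 * y\<^sup>2 + 2 * C)) + ennreal (2 * y\<^sup>2)"
      using C(1) by (intro arg_cong2[where f="(+)"] two) simp_all
    also have "\<dots> = ennreal (6 * y\<^sup>2 + 4 * C)"
      using C(1) by (subst ennreal_plus[symmetric]) (simp_all del: ennreal_plus)
    finally show "(\<integral>\<^sup>+\<omega>. ennreal ((T \<omega> - y)\<^sup>2) \<partial>completion M) \<le> ennreal (6 * y\<^sup>2 + 4 * C)" .
    show "AE \<omega> in completion M. (\<lambda>k. grid_value k \<omega>) \<longlonglongrightarrow> T \<omega> - y"
      using fin AE_space by eventually_elim (auto simp: T_def intro!: grid_value_tendsto)
  qed measurable
  then have "expectation (\<lambda>\<omega>. T \<omega> - y) = 0"
    by (simp add: expectation_grid_value LIMSEQ_const_iff)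
  then have "expectation T = y"
    using intT by (simp add: prob_space[simplified])
  moreover have "(\<integral>\<^sup>+\<omega>. \<tau> \<omega> \<partial>completion M) = (\<integral>\<^sup>+\<omega>. ennreal (T \<omega>) \<partial>completion M)"
  proof (rule nn_integral_cong_AE)
    show "AE \<omega> in completion M. \<tau> \<omega> = ennreal (T \<omega>)"
      using fin by eventually_elim (simp add: T_def)
  qed
  moreover have "\<dots> = ennreal (expectation T)"
    by (intro nn_integral_eq_integral intT) (simp add: T_def)
  ultimately show "(\<integral>\<^sup>+\<omega>. \<tau> \<omega> \<partial>completion M) = ennreal y"
    by simp
qed

end

end

section \<open>Combination of the two suboptimality hypotheses\<close>

theorem theorem3:
  fixes P :: "real \<Rightarrow> 'a measure" and W :: "real \<Rightarrow> 'a \<Rightarrow> real"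
    and f g :: "real \<Rightarrow> real" and x y \<epsilon> :: real
    and \<alpha> I :: "real \<Rightarrow> 'a \<Rightarrow> real"
  assumes "brownian_family P W"
    and "continuous_on UNIV f" and "bdd_above (range f)"
    and "continuous_on {0..} g"
    and "\<epsilon> > 0"
    and "y \<ge> 0"
    and "stopping_value P W f g x \<le> aux_value P W f x y + ereal (g y) + ereal \<epsilon>"
    and "\<alpha> \<in> controls P W x" and "ito P W x \<alpha> I"
    and "aux_value P W f x y \<le> expected_payoff P W f x (hitting_time y I) + ereal \<epsilon>"
  shows "hitting_time y I \<in> stopping_times P W x \<and>
         stopping_value P W f g x
           \<le> expected_payoff P W f x (hitting_time y I)
             + ereal (g (expected_time P x (hitting_time y I))) + ereal (2 * \<epsilon>)"
proof -
  interpret ito_process "P x" W x \<alpha> I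
  proof
    show "brownian_motion (P x) W x"
      using assms(1) by (simp add: brownian_family_def)
    show "ito P W x \<alpha> I" by fact
  qed
  have \<alpha>: "progressively_measurable (filt P W x) \<alpha>" "energy (law P x) \<alpha> < \<infinity>"
    using \<open>\<alpha> \<in> controls P W x\<close> by (auto simp: controls_def)
  note moments = hitting_time_moments[OF \<open>y \<ge> 0\<close> \<alpha>]
  have "expected_time P x (hitting_time y I) = y"
    using moments(2) \<open>y \<ge> 0\<close> by (simp add: expected_time_def)
  moreover have "stopping_value P W f g x \<le>
      (expected_payoff P W f x (hitting_time y I) + ereal \<epsilon>) + ereal (g y) + ereal \<epsilon>"
    using assms(7) add_right_mono[OF add_right_mono[OF assms(10)]] by (rule order_trans)
  \<comment> \<open>The payoff may be minus infinity, so the regrouping is checked case by case in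
    \<open>ereal\<close>.\<close>
  moreover have "\<dots> = expected_payoff P W f x (hitting_time y I) + ereal (g y) + ereal (2 * \<epsilon>)"
    by (cases "expected_payoff P W f x (hitting_time y I)") auto
  ultimately show ?thesis
    using moments(1) stopping_time_hitting_time by (simp add: stopping_times_def)
qed

end
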